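(* Let $\{\mathbf Z^{(n)}\}_{n\ge0}$ be a linear-fractional multi-type Bienaym\'e-Galton-Watson process with parameters $(\mathbf H,\mathbf g,m)$, starting from a single particle, whose mean matrix $\mathbf M=\mathbf H+m\mathbf H\mathbf 1^{\mathrm t}\mathbf g$ is irreducible and aperiodic, and assume $\beta<\infty$. Suppose that $\rho<1$, or equivalently $\mu<1$ (the subcritical positively recurrent case). Then, as $n\to\infty$, $$\mathbb P(\mathbf Z^{(n)}\ne\mathbf 0)\sim\rho^n(1+m)^{-1}(1-\mu)\mathbf u^{\mathrm t},$$ where $\mathbb P(\mathbf Z^{(n)}\ne\mathbf 0)$ denotes the column vector with elements $\mathbb P(\mathbf Z^{(n)}\ne\mathbf 0\mid\mathbf Z^{(0)}=\mathbf e_i)$, $i\ge1$, and $\sim$ is understood component-wise. Furthermore, for any initial type $i\ge1$, $$\mathbb P\big(\mathbf Z^{(n)}=\mathbf k\mid\mathbf Z^{(n)}\ne\mathbf 0,\mathbf Z^{(0)}=\mathbf e_i\big)\to\mathbb P(\mathbf Y=\mathbf k)\quad\text{for all }\mathbf k\in\mathbb Z_+^\infty,$$ where $\mathbf Y$ has the distribution $\mathrm{LF}(\tilde{\mathbf h},\tilde{\mathbf g},\tilde m)$ with $\tilde m=m\lambda(1-\mu)^{-1}$, $$\tilde{\mathbf h}=(1+m)(1-\mu)^{-1}\mathbf v-m\mathbf g(\mathbf I-\mathbf M)^{-1},\qquad\tilde{\mathbf h}\mathbf 1^{\mathrm t}=1,$$ $$\tilde{\mathbf g}=\lambda^{-1}(1-\mu)\mathbf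 g(\mathbf I-\mathbf M)^{-1}.$$
   Context: Vectors are row vectors indexed by $\{1,2,\ldots\}$; $\mathbf x^{\mathrm t}$ denotes the transpose; $\mathbf 1=(1,1,\ldots)$; $\mathbf 0=(0,0,\ldots)$; $\mathbf e_i$ is the $i$-th unit vector; $\mathbf I$ is the unit matrix; $\mathbf s^{\mathbf x}=s_1^{x_1}s_2^{x_2}\cdots$; $\mathbb Z_+^\infty$ is the set of vectors with non-negative integer components and finite sum. $(\mathbf I-\mathbf M)^{-1}$ stands for $\sum_{k\ge0}\mathbf M^k$. Parameters: $\mathbf H=(h_{ij})_{i,j\ge1}$ is a sub-stochastic matrix (non-negative entries, row sums at most $1$), $\mathbf g=(g_1,g_2,\ldots)$ a probability distribution on $\{1,2,\ldots\}$, $m>0$ a constant. Linear-fractional distribution: for a probability distribution $(h_0,h_1,h_2,\ldots)$ on $\{0,1,2,\ldots\}$ with $\mathbf h=(h_1,h_2,\ldots)$, a random vector $\mathbf Z$ in $\mathbb Z_+^\infty$ has distribution $\mathrm{LF}(\mathbf h,\mathbf g,m)$ if $$\mathbb E(\mathbf s^{\mathbf Z})=h_0+\frac{\sum_{i\ge1}h_is_i}{1+m-m\sum_{i\ge1}g_is_i},\qquad\mathbf s\in[0,1]^\infty.$$ Process: in a multi-type Bienaym\'e-Galton-Watson process with types $1,2,\ldots$ each particle lives one unit of time and at death produces offspring independently of all other particles, with law depending only on its type; $\mathbf Z^{(n)}=(Z_1^{(n)},Z_2^{(n)},\ldots)$, where $Z_j^{(n)}$ is the number of type $j$ particles at time $n$.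 It is linear-fractional with parameters $(\mathbf H,\mathbf g,m)$ if, for each $i$, the offspring vector of a type $i$ particle has distribution $\mathrm{LF}(\mathbf h_i,\mathbf g,m)$, $\mathbf h_i$ being the $i$-th row of $\mathbf H$. Its mean matrix, with entries $\mathbb E(Z_j^{(1)}\mid\mathbf Z^{(0)}=\mathbf e_i)$, is $\mathbf M$. Irreducible: for every $(i,j)$ some power $\mathbf M^n$, $n\ge1$, has positive $(i,j)$ entry; aperiodic: the greatest common divisor of all $n\ge1$ such that $(\mathbf M^n)_{ii}>0$ equals $1$. Further quantities: $d_n=\mathbf g\mathbf H^n\mathbf 1^{\mathrm t}$ ($n\ge1$); $f(s)=\sum_{n\ge1}d_ns^n$; $R_f=\inf\{s>0:f(s)=\infty\}$ (with $\inf\emptyset=\infty$, $f(\infty)=\lim_{s\to\infty}f(s)$). If $f(R_f)\ge1/m$, then $\alpha$ is the unique real solution of $mf(e^{-\alpha})=1$ and $\beta=m\sum_{n\ge1}nd_ne^{-\alpha n}$; if $f(R_f)<1/m$, then $\alpha=-\infty$ and $\beta=\infty$. When $\alpha>-\infty$: $R=e^{-\alpha}$ and $\rho=R^{-1}=e^{\alpha}$. Also $\lambda=1+f(1)$ and $\mu=m(\lambda-1)=mf(1)$. Finally $$\mathbf u^{\mathrm t}=(1+m)\beta^{-1}\sum_{k=1}^\infty R^k\mathbf H^k\mathbf 1^{\mathrm t},\qquad\mathbf v=\frac m{1+m}\sum_{k=0}^\infty R^k\mathbf g\mathbf H^k.$$ *)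

theory Defs
  imports "HOL-Probability.Probability" "HOL-Library.Landau_Symbols"
begin

(* Conventions.  Types are indexed by the natural numbers 0, 1, 2, ... instead of 1, 2, 3, ...
   A vector of non-negative integers with finite sum is a finite multiset of types: the i-th
   component of x is "count x i", the unit vector e_i is "{#i#}" and the zero vector is "{#}".
   Real vectors and matrices are functions; sums over all types are series.  A non-negative
   quantity that the theory allows to be infinite takes values in ennreal. *)

type_synonym rvec = "nat \<Rightarrow> real"
type_synonym rmat = "nat \<Rightarrow> nat \<Rightarrow> real"

definition mat_mult :: "rmat \<Rightarrow> rmat \<Rightarrow> rmat" where
  "mat_mult A B = (\<lambda>i j. \<Sum>l. A i l * B l j)"

definition id_mat :: rmat where
  "id_mat = (\<lambda>i j. if i = j then 1 else 0)"

primrec mat_power :: "rmat \<Rightarrow> nat \<Rightarrow> rmat" where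
  "mat_power A 0 = id_mat"
| "mat_power A (Suc n) = mat_mult A (mat_power A n)"

definition vec_mat :: "rvec \<Rightarrow> rmat \<Rightarrow> rvec" where
  "vec_mat x A = (\<lambda>j. \<Sum>i. x i * A i j)"

definition row_sums :: "rmat \<Rightarrow> rvec" where
  "row_sums A = (\<lambda>i. \<Sum>j. A i j)"

(* (I - A)^(-1), understood as the sum of all powers of A *)
definition neumann_inverse :: "rmat \<Rightarrow> rmat" where
  "neumann_inverse A = (\<lambda>i j. \<Sum>k. mat_power A k i j)"

definition sub_prob_vec :: "rvec \<Rightarrow> bool" where
  "sub_prob_vec h \<longleftrightarrow> (\<forall>i. 0 \<le> h i) \<and> summable h \<and> suminf h \<le> 1"

definition prob_vec :: "rvec \<Rightarrow> bool" where
  "prob_vec g \<longleftrightarrow> (\<forall>i. 0 \<le> g i) \<and> g sums 1"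

definition sub_stochastic :: "rmat \<Rightarrow> bool" where
  "sub_stochastic A \<longleftrightarrow> (\<forall>i. sub_prob_vec (A i))"

definition irreducible_mat :: "rmat \<Rightarrow> bool" where
  "irreducible_mat A \<longleftrightarrow> (\<forall>i j. \<exists>n\<ge>1. 0 < mat_power A n i j)"

definition aperiodic_mat :: "rmat \<Rightarrow> bool" where
  "aperiodic_mat A \<longleftrightarrow> (\<forall>i. Gcd {n. 1 \<le> n \<and> 0 < mat_power A n i i} = (1::nat))"

(* The linear-fractional law LF(h, g, m).  The mass h_0 missing from h is 1 - sum_i h_i, and
   s^x is the product of s over the multiset x. *)
definition LF :: "nat multiset pmf \<Rightarrow> rvec \<Rightarrow> rvec \<Rightarrow> real \<Rightarrow> bool" where
  "LF q h g m \<longleftrightarrow> sub_prob_vec h \<and> prob_vec g \<and> 0 < m \<and>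
     (\<forall>s. (\<forall>i. 0 \<le> s i \<and> s i \<le> 1) \<longrightarrow>
        measure_pmf.expectation q (\<lambda>x. \<Prod>i\<in>#x. s i) =
          (1 - (\<Sum>i. h i)) + (\<Sum>i. h i * s i) / (1 + m - m * (\<Sum>i. g i * s i)))"

(* Law of the next generation of the population x: the particles, labelled (j, l) with
   l < count x j, have independent offspring vectors, that of (j, l) having law p j. *)
definition next_generation :: "(nat \<Rightarrow> nat multiset pmf) \<Rightarrow> nat multiset \<Rightarrow> nat multiset pmf" where
  "next_generation p x =
     (let particles = (SIGMA j:set_mset x. {..<count x j})
      in map_pmf (\<lambda>Y. \<Sum>a\<in>particles. Y a) (Pi_pmf particles {#} (\<lambda>(j, l). p j)))"

(* The process Z with offspring laws p, started from one particle of type i under P, as a Markov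
   chain given by its finite-dimensional distributions. *)
definition BGW_process ::
  "(nat \<Rightarrow> nat multiset pmf) \<Rightarrow> nat \<Rightarrow> 'w measure \<Rightarrow> (nat \<Rightarrow> 'w \<Rightarrow> nat multiset) \<Rightarrow> bool" where
  "BGW_process p i P Z \<longleftrightarrow>
     prob_space P \<and>
     (\<forall>n. Z n \<in> measurable P (count_space UNIV)) \<and>
     (AE \<omega> in P. Z 0 \<omega> = {#i#}) \<and>
     (\<forall>n x. \<P>(\<omega> in P. \<forall>t\<le>Suc n. Z t \<omega> = x t) =
              \<P>(\<omega> in P. \<forall>t\<le>n. Z t \<omega> = x t) * pmf (next_generation p (x n)) (x (Suc n)))"

(* P i is the conditional law given that the process starts from one particle of type i. *)
definition LF_BGW ::
  "rmat \<Rightarrow> rvec \<Rightarrow> real \<Rightarrow> (nat \<Rightarrow> 'w measure) \<Rightarrow> (nat \<Rightarrow> 'w \<Rightarrow> nat multiset) \<Rightarrow> bool" where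
  "LF_BGW H g m P Z \<longleftrightarrow>
     (\<exists>p. (\<forall>i. LF (p i) (H i) g m) \<and> (\<forall>i. BGW_process p i (P i) Z))"

definition mean_matrix :: "(nat \<Rightarrow> 'w measure) \<Rightarrow> (nat \<Rightarrow> 'w \<Rightarrow> nat multiset) \<Rightarrow> rmat" where
  "mean_matrix P Z = (\<lambda>i j. \<integral>\<omega>. real (count (Z 1 \<omega>) j) \<partial>P i)"

definition d_seq :: "rmat \<Rightarrow> rvec \<Rightarrow> nat \<Rightarrow> real" where
  "d_seq H g n = (\<Sum>i. g i * row_sums (mat_power H n) i)"

(* In ennreal, f at infinity is the limit of f(s) as s tends to infinity, since 0 * \<infinity> = 0;
   see f_gen_tendsto_top. *)
definition f_gen :: "rmat \<Rightarrow> rvec \<Rightarrow> ennreal \<Rightarrow> ennreal" where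
  "f_gen H g s = (\<Sum>n. ennreal (d_seq H g (Suc n)) * s ^ Suc n)"

lemma f_gen_tendsto_top: "((\<lambda>s::real. f_gen H g (ennreal s)) \<longlongrightarrow> f_gen H g \<infinity>) at_top"
proof (cases "\<exists>n. 0 < d_seq H g (Suc n)")
  case False
  then have "ennreal (d_seq H g (Suc n)) = 0" for n
    by (meson ennreal_neg not_le_imp_less)
  then show ?thesis by (simp add: f_gen_def)
next
  case True
  then obtain n where n: "0 < d_seq H g (Suc n)" by blast
  have le: "ennreal (d_seq H g (Suc n)) * s ^ Suc n \<le> f_gen H g s" for s
    unfolding f_gen_def
    using sum_le_suminf[of "\<lambda>n. ennreal (d_seq H g (Suc n)) * s ^ Suc n" "{n}"] by simp
  have "f_gen H g \<infinity> = \<infinity>"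
    using le[of \<infinity>] n by (simp add: ennreal_mult_eq_top_iff ennreal_top_mult ennreal_mult_top top_unique)
  moreover have "((\<lambda>s::real. f_gen H g (ennreal s)) \<longlongrightarrow> \<infinity>) at_top"
    unfolding infinity_ennreal_def tendsto_top_iff_ennreal
  proof (intro allI impI)
    fix l :: real assume l: "0 \<le> l"
    have "eventually (\<lambda>s. s > max 1 (l / d_seq H g (Suc n))) at_top"
      by (rule eventually_gt_at_top)
    then show "\<forall>\<^sub>F s in at_top. ennreal l < f_gen H g (ennreal s)"
    proof eventually_elim
      case (elim s)
      then have s: "1 < s" "l < d_seq H g (Suc n) * s"
        using n by (simp_all add: field_simps)
      have "s \<le> s ^ Suc n" using s(1) by (simp add: self_le_power)
      then have "d_seq H g (Suc n) * s \<le> d_seq H g (Suc n) * s ^ Suc n"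
        using n by (intro mult_left_mono) auto
      then have "ennreal l < ennreal (d_seq H g (Suc n) * s ^ Suc n)"
        using s l by (intro ennreal_lessI) (auto intro: le_less_trans)
      also have "\<dots> = ennreal (d_seq H g (Suc n)) * ennreal s ^ Suc n"
        using n s by (simp only: ennreal_mult' ennreal_power less_imp_le)
      also have "\<dots> \<le> f_gen H g (ennreal s)" by (rule le)
      finally show ?case .
    qed
  qed
  ultimately show ?thesis by simp
qed

definition R_f :: "rmat \<Rightarrow> rvec \<Rightarrow> ennreal" where
  "R_f H g = Inf {ennreal s | s. 0 < s \<and> f_gen H g (ennreal s) = \<infinity>}"

definition lf_alpha :: "rmat \<Rightarrow> rvec \<Rightarrow> real \<Rightarrow> ereal" where
  "lf_alpha H g m =
     (if f_gen H g (R_f H g) \<ge> ennreal (1 / m)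
      then ereal (THE a. ennreal m * f_gen H g (ennreal (exp (- a))) = 1)
      else - \<infinity>)"

definition lf_beta :: "rmat \<Rightarrow> rvec \<Rightarrow> real \<Rightarrow> ennreal" where
  "lf_beta H g m =
     (if f_gen H g (R_f H g) \<ge> ennreal (1 / m)
      then ennreal m * (\<Sum>n. ennreal (real (Suc n) * d_seq H g (Suc n)
                                 * exp (- (real_of_ereal (lf_alpha H g m) * real (Suc n)))))
      else \<infinity>)"

(* R and rho are meaningful only for alpha > -\<infinity>. *)
definition lf_R :: "rmat \<Rightarrow> rvec \<Rightarrow> real \<Rightarrow> real" where
  "lf_R H g m = exp (- real_of_ereal (lf_alpha H g m))"

definition lf_rho :: "rmat \<Rightarrow> rvec \<Rightarrow> real \<Rightarrow> real" where
  "lf_rho H g m = exp (real_of_ereal (lf_alpha H g m))"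

definition lf_lambda :: "rmat \<Rightarrow> rvec \<Rightarrow> ennreal" where
  "lf_lambda H g = 1 + f_gen H g 1"

definition lf_mu :: "rmat \<Rightarrow> rvec \<Rightarrow> real \<Rightarrow> ennreal" where
  "lf_mu H g m = ennreal m * f_gen H g 1"

definition lf_u :: "rmat \<Rightarrow> rvec \<Rightarrow> real \<Rightarrow> rvec" where
  "lf_u H g m = (\<lambda>i. (1 + m) / enn2real (lf_beta H g m) *
     (\<Sum>k. lf_R H g m ^ Suc k * row_sums (mat_power H (Suc k)) i))"

definition lf_v :: "rmat \<Rightarrow> rvec \<Rightarrow> real \<Rightarrow> rvec" where
  "lf_v H g m = (\<lambda>j. m / (1 + m) * (\<Sum>k. lf_R H g m ^ k * vec_mat g (mat_power H k) j))"

(* The parameters of the limit law; M is the mean matrix.  They are used only when mu < 1, so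
   that lambda and mu are finite. *)
definition m_tilde :: "rmat \<Rightarrow> rvec \<Rightarrow> real \<Rightarrow> real" where
  "m_tilde H g m = m * enn2real (lf_lambda H g) / (1 - enn2real (lf_mu H g m))"

definition h_tilde :: "rmat \<Rightarrow> rvec \<Rightarrow> real \<Rightarrow> rmat \<Rightarrow> rvec" where
  "h_tilde H g m M = (\<lambda>j. (1 + m) / (1 - enn2real (lf_mu H g m)) * lf_v H g m j
                            - m * vec_mat g (neumann_inverse M) j)"

definition g_tilde :: "rmat \<Rightarrow> rvec \<Rightarrow> real \<Rightarrow> rmat \<Rightarrow> rvec" where
  "g_tilde H g m M = (\<lambda>j. (1 - enn2real (lf_mu H g m)) / enn2real (lf_lambda H g)
                            * vec_mat g (neumann_inverse M) j)"

end

(* Put t = 1 - s.  The offspring generating functions satisfy 1 - F(s) = M t / (1 + m g t), so the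
   iterates are explicit: the n-th one is 1 - M^n t / (1 + m sum_{k<n} g M^k t).  Hence everything
   reduces to the asymptotics of M^n w for bounded w.  As M = H + m H 1 g, the numbers g M^n w solve
   the renewal equation x_n = g H^n w + sum_{k=1}^n m d_k x_{n-k}; after multiplication by R^n the
   weights m d_k R^k form a probability distribution with mean beta, which is aperiodic because M is,
   and the renewal theorem gives R^n M^n w -> u^t (v w).  For R > 1 the series
   sum_k g M^k w converges, so the conditional generating functions have a limit, which is the one
   of the linear-fractional law; convergence of generating functions implies convergence in law. *)

theory Submission
  imports Defs
begin

text \<open>With infinitely many types, entrywise limits of M^n do not suffice: the vectors t may
  have infinitely many non-zero entries, so limits must pass through series over types. The way out
  is that the renewal equation is scalar: g averages over the types, and w enters only through the
  source term g H^n w, whose series with weights R^n converges. Finite \<beta> is the finite mean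
  that keeps the renewal limit positive. The constants come from w = 1. As m f(R) = 1, the sum of
  d_n R^n over n \<ge> 0 is (1 + m)/m, that is, v has total mass 1. As m \<lambda> = m + \<mu>, the
  limiting denominator at t = 1 is (1 + m)/(1 - \<mu>), and its reciprocal is the factor in the
  survival asymptotics. The same two values give the limiting h total mass 1; it is non-negative
  because the weights R^k in v are at least 1. The initial type survives in the limits only as the
  factor u_i, which cancels under conditioning. That the candidate parameters belong to an actual
  law is shown by constructing it: one particle plus a geometric number of further ones.\<close>

section \<open>Discrete renewal theorem\<close>

text \<open>In \<open>ennreal\<close> the interchange is unconditional; the summability hypotheses
  bring both sides back to the reals. Every exchange of two series of non-negative terms below goes
  through this lemma.\<close>

lemma tonelli_series:
  fixes a :: "nat \<Rightarrow> nat \<Rightarrow> real"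
  assumes nn: "\<And>k j. 0 \<le> a k j"
    and row: "\<And>k. summable (a k)" and tot: "summable (\<lambda>k. \<Sum>j. a k j)"
  shows "summable (\<lambda>k. a k j)"
    and "(\<lambda>j. \<Sum>k. a k j) sums (\<Sum>k. \<Sum>j. a k j)"
proof -
  have inner: "(\<Sum>j. ennreal (a k j)) = ennreal (\<Sum>j. a k j)" for k
    using row nn by (intro suminf_ennreal2)
  have total: "(\<Sum>k. \<Sum>j. ennreal (a k j)) = ennreal (\<Sum>k. \<Sum>j. a k j)"
    unfolding inner using tot nn row by (intro suminf_ennreal2) (auto intro: suminf_nonneg)
  have "(\<Sum>j. \<Sum>k. ennreal (a k j)) = (\<integral>\<^sup>+j. (\<Sum>k. ennreal (a k j)) \<partial>count_space UNIV)"
    by (simp add: nn_integral_count_space_nat)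
  also have "\<dots> = (\<Sum>k. \<integral>\<^sup>+j. ennreal (a k j) \<partial>count_space UNIV)"
    by (intro nn_integral_suminf) auto
  also have "\<dots> = (\<Sum>k. \<Sum>j. ennreal (a k j))"
    by (simp add: nn_integral_count_space_nat)
  finally have swap: "(\<Sum>j. \<Sum>k. ennreal (a k j)) = ennreal (\<Sum>k. \<Sum>j. a k j)"
    using total by simp
  have fin: "(\<Sum>k. ennreal (a k j)) \<noteq> top" for j
  proof -
    have "(\<Sum>k. ennreal (a k j)) \<le> (\<Sum>j. \<Sum>k. ennreal (a k j))"
      using sum_le_suminf[of "\<lambda>j. \<Sum>k. ennreal (a k j)" "{j}"] by simp
    then show ?thesis unfolding swap by (metis ennreal_neq_top top_unique)
  qed
  show col: "summable (\<lambda>k. a k j)" for j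
    using fin nn by (intro summable_suminf_not_top)
  have cole: "(\<Sum>k. ennreal (a k j)) = ennreal (\<Sum>k. a k j)" for j
    using col nn by (intro suminf_ennreal2)
  have nnc: "0 \<le> (\<Sum>k. a k j)" for j using col nn by (intro suminf_nonneg)
  have "(\<lambda>j. ennreal (\<Sum>k. a k j)) sums ennreal (\<Sum>k. \<Sum>j. a k j)"
    using swap unfolding cole by (metis summableI summable_sums)
  then show "(\<lambda>j. \<Sum>k. a k j) sums (\<Sum>k. \<Sum>j. a k j)"
    using nnc by (subst (asm) sums_ennreal) (auto intro!: suminf_nonneg tot row nn)
qed

lemma suminf_eq_sum_atMost:
  fixes f :: "nat \<Rightarrow> real"
  shows "(\<Sum>k. if k \<le> n then f k else 0) = (\<Sum>k\<le>n. f k)"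
proof -
  have "(\<Sum>k. if k \<le> n then f k else 0) = (\<Sum>k\<le>n. if k \<le> n then f k else 0)"
    by (intro suminf_finite) auto
  then show ?thesis by simp
qed

text \<open>Dominated convergence for series, with dominating terms \<open>x k * C\<close>. It is
  stated along \<open>N\<close> because the limit superior argument below controls a solution only
  near the points \<open>N n\<close>, at every fixed distance \<open>k\<close>.\<close>

lemma convolution_tendsto_along:
  fixes x y :: "nat \<Rightarrow> real"
  assumes x: "\<And>k. 0 \<le> x k" "summable x" and C: "\<And>n. \<bar>y n\<bar> \<le> C"
    and N: "filterlim N at_top sequentially" and y: "\<And>k. (\<lambda>n. y (N n - k)) \<longlonglongrightarrow> L"
  shows "(\<lambda>n. \<Sum>k\<le>N n. x k * y (N n - k)) \<longlonglongrightarrow> (\<Sum>k. x k) * L"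
proof -
  let ?a = "\<lambda>k n. if k \<le> N n then x k * y (N n - k) else 0"
  have "(\<lambda>n. \<Sum>k. ?a k n) \<longlonglongrightarrow> (\<Sum>k. x k * L)"
  proof (rule conjunct2[OF conjunct2[OF tannerys_theorem[where M = "\<lambda>k. x k * C"]]])
    fix k
    have "(\<lambda>n. x k * y (N n - k)) \<longlonglongrightarrow> x k * L" by (intro tendsto_intros y)
    moreover have "\<forall>\<^sub>F n in sequentially. x k * y (N n - k) = ?a k n"
      using spec[OF N[unfolded filterlim_at_top], of k] by (rule eventually_mono) simp
    ultimately show "(\<lambda>n. ?a k n) \<longlonglongrightarrow> x k * L" by (rule Lim_transform_eventually)
  next
    have "norm (?a k n) \<le> x k * C" for k n
      using C[of "N n - k"] C[of 0] x(1)[of k]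
      by (auto simp: abs_mult intro: mult_left_mono mult_nonneg_nonneg)
    then show "\<forall>\<^sub>F (k, n) in sequentially \<times>\<^sub>F sequentially. norm (?a k n) \<le> x k * C"
      by (intro always_eventually) auto
  qed (use x in \<open>auto intro: summable_mult2\<close>)
  then show ?thesis
    by (simp add: suminf_eq_sum_atMost suminf_mult2[OF x(2)])
qed

lemma convolution_tendsto:
  fixes x y :: "nat \<Rightarrow> real"
  assumes x: "\<And>k. 0 \<le> x k" "summable x" and y: "y \<longlonglongrightarrow> L"
  shows "(\<lambda>n. \<Sum>k\<le>n. x k * y (n - k)) \<longlonglongrightarrow> (\<Sum>k. x k) * L"
proof -
  obtain C where "\<And>n. \<bar>y n\<bar> \<le> C"
    using convergent_imp_Bseq[OF convergentI[OF y]] unfolding Bseq_def by auto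
  moreover have "(\<lambda>n. y (n - k)) \<longlonglongrightarrow> L" for k
    using LIMSEQ_offset[of "\<lambda>n. y (n - k)" k] y by simp
  ultimately show ?thesis
    using convolution_tendsto_along[OF x _ filterlim_ident] by blast
qed

text \<open>The differences of elements of \<open>A\<close> form a subgroup of the integers. Its
  least positive element divides all of \<open>A\<close>, so it is 1, and \<open>A\<close> contains
  some b and b + 1. If n = q b + r with r < b, then n = (q - r) b + r (b + 1), and n \<ge> b^2
  ensures q \<ge> r.\<close>

lemma additive_set_contains_all_large:
  fixes A :: "nat set"
  assumes zero: "0 \<in> A" and add: "\<And>a b. a \<in> A \<Longrightarrow> b \<in> A \<Longrightarrow> a + b \<in> A"
    and gcd: "Gcd A = 1"
  shows "\<exists>K. \<forall>n\<ge>K. n \<in> A"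
proof -
  have mult: "k * a \<in> A" if "a \<in> A" for a k
    by (induction k) (auto simp: zero that add)
  define D where "D = {d. \<exists>a\<in>A. \<exists>b\<in>A. d = int a - int b}"
  define D' where "D' = {n::nat. 0 < n \<and> int n \<in> D}"
  have Dadd: "x + y \<in> D" if "x \<in> D" "y \<in> D" for x y
  proof -
    from that obtain a b c e where "a \<in> A" "b \<in> A" "c \<in> A" "e \<in> A" "x = int a - int b" "y = int c - int e"
      unfolding D_def by auto
    then show ?thesis unfolding D_def
      by (intro CollectI bexI[of _ "a + c"] bexI[of _ "b + e"]) (auto intro: add)
  qed
  have Dneg: "- x \<in> D" if "x \<in> D" for x
    using that unfolding D_def by force
  have D0: "0 \<in> D" using zero unfolding D_def by force
  have Dmult: "int k * x \<in> D" if "x \<in> D" for k x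
    by (induction k) (auto simp: D0 that Dadd algebra_simps)
  have AD: "int a \<in> D" if "a \<in> A" for a
    using that zero unfolding D_def by force
  have "\<exists>a\<in>A. 0 < a"
  proof (rule ccontr)
    assume "\<not> ?thesis"
    then have "A \<subseteq> {0}" by auto
    then have "Gcd A = 0" by (simp add: Gcd_0_iff)
    with gcd show False by simp
  qed
  then have "D' \<noteq> {}" unfolding D'_def using AD by blast
  define q where "q = (LEAST n. n \<in> D')"
  have q: "q \<in> D'" unfolding q_def using \<open>D' \<noteq> {}\<close> by (metis LeastI_ex all_not_in_conv)
  have "q dvd a" if "a \<in> A" for a
  proof (rule ccontr)
    assume nd: "\<not> q dvd a"
    have "int (a mod q) = int a + - (int (a div q) * int q)"
      by (simp add: minus_div_mult_eq_mod[symmetric] zmod_int zdiv_int)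
    also have "\<dots> \<in> D" using q that AD Dmult Dneg Dadd unfolding D'_def by blast
    finally have "a mod q \<in> D'" using nd unfolding D'_def by (simp add: mod_greater_zero_iff_not_dvd)
    moreover have "a mod q < q" using q unfolding D'_def by simp
    ultimately show False using not_less_Least unfolding q_def by blast
  qed
  then have "q dvd Gcd A" by (rule Gcd_greatest)
  with gcd q have "1 \<in> D" unfolding D'_def by simp
  then obtain a b where a: "a \<in> A" and b: "b \<in> A" and ab: "a = b + 1"
    unfolding D_def by (smt (verit, best) mem_Collect_eq of_nat_1 of_nat_add of_nat_eq_iff)
  show ?thesis
  proof (cases "b = 0")
    case True
    then have "n \<in> A" for n using mult[of 1 n] a ab by simp
    then show ?thesis by auto
  next
    case False
    show ?thesis
    proof (intro exI[of _ "b * b"] allI impI)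
      fix n assume n: "b * b \<le> n"
      have "b \<le> n div b" using n False by (simp add: div_le_mono[of "b*b" n b, simplified])
      moreover have "n mod b < b" using False by simp
      ultimately have le: "n mod b \<le> n div b" by simp
      have "(n div b - n mod b) * b + (n mod b) * a = (n div b) * b + n mod b"
        using le unfolding ab by (simp add: diff_mult_distrib algebra_simps)
      then have "(n div b - n mod b) * b + (n mod b) * a = n" by simp
      then show "n \<in> A" using mult[OF b] mult[OF a] add by metis
    qed
  qed
qed

section \<open>The renewal equation for an aperiodic step law with finite mean\<close>

locale renewal =
  fixes p :: "nat \<Rightarrow> real"
  assumes p0: "p 0 = 0" and pnn: "0 \<le> p n" and psum: "p sums 1"
    and gcd: "Gcd {n. 0 < p n} = 1" and mean: "summable (\<lambda>n. real n * p n)"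
begin

text \<open>The probability that a step is longer than \<open>k\<close>.\<close>

definition tail :: "nat \<Rightarrow> real" where "tail k = 1 - (\<Sum>j\<le>k. p j)"

lemma partial_le: "(\<Sum>j\<le>k. p j) \<le> 1"
  using sum_le_suminf[of p "{..k}"] psum pnn by (auto simp: sums_iff)

text \<open>The weight \<open>p j\<close> is counted once for each k < j, and the two orders of
  summation are compared.\<close>

lemma tail_sums: "tail sums (\<Sum>n. real n * p n)"
proof -
  let ?a = "\<lambda>j k. if k < j then p j else 0"
  have row: "(\<lambda>k. ?a j k) sums (real j * p j)" for j
    using sums_finite[of "{..<j}" "\<lambda>k. ?a j k"] by simp
  have col: "(\<Sum>j. ?a j k) = tail k" for k
  proof -
    have "(\<lambda>j. p j - (if j \<le> k then p j else 0)) sums (1 - (\<Sum>j\<le>k. if j \<le> k then p j else 0))"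
      by (intro sums_diff psum sums_finite) auto
    moreover have "(\<lambda>j. p j - (if j \<le> k then p j else 0)) = (\<lambda>j. ?a j k)" by auto
    ultimately show ?thesis by (simp add: sums_iff tail_def)
  qed
  have "(\<lambda>k. \<Sum>j. ?a j k) sums (\<Sum>j. \<Sum>k. ?a j k)"
    by (rule tonelli_series(2)) (use row mean pnn in \<open>auto simp: sums_iff\<close>)
  then show ?thesis unfolding col row[THEN sums_unique, symmetric] .
qed

lemma tail_nonneg: "0 \<le> tail k"
  using partial_le[of k] by (simp add: tail_def)

lemma mean_pos: "0 < (\<Sum>n. real n * p n)"
proof -
  have "tail 0 \<le> (\<Sum>n. tail n)"
    using sum_le_suminf[of tail "{0}"] tail_sums tail_nonneg by (simp add: sums_iff)
  then show ?thesis using tail_sums by (simp add: tail_def[of 0] p0 sums_iff)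
qed

text \<open>The source \<open>b\<close> may have any sign, so that \<open>- u\<close> solves the
  equation with source \<open>- b\<close>. An upper bound for all solutions is then also a lower
  bound.\<close>

definition solution :: "(nat \<Rightarrow> real) \<Rightarrow> (nat \<Rightarrow> real) \<Rightarrow> bool" where
  "solution b u \<longleftrightarrow> summable (\<lambda>n. \<bar>b n\<bar>) \<and> (\<forall>n. u n = b n + (\<Sum>k\<le>n. p k * u (n - k)))"

text \<open>The induction runs on the sharper bound by the partial sum of |b k| up to n. As
  \<open>p 0 = 0\<close>, the convolution involves only earlier values of \<open>u\<close>, and with
  weights of total mass at most 1 it does not exceed their bound; time n adds only |b n|.\<close>

lemma solution_bounded:
  assumes "solution b u" shows "\<bar>u n\<bar> \<le> (\<Sum>k. \<bar>b k\<bar>)"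
proof -
  have "\<bar>u n\<bar> \<le> (\<Sum>k\<le>n. \<bar>b k\<bar>)"
  proof (induction n rule: less_induct)
    case (less n)
    show ?case
    proof (cases "n = 0")
      case False
      have "\<bar>\<Sum>k\<le>n. p k * u (n - k)\<bar> \<le> (\<Sum>k\<le>n. p k * (\<Sum>k<n. \<bar>b k\<bar>))"
      proof (intro order_trans[OF sum_abs] sum_mono)
        fix k assume "k \<in> {..n}"
        show "\<bar>p k * u (n - k)\<bar> \<le> p k * (\<Sum>k<n. \<bar>b k\<bar>)"
        proof (cases "k = 0")
          case k: False
          have "\<bar>u (n - k)\<bar> \<le> (\<Sum>k\<le>n - k. \<bar>b k\<bar>)" using less[of "n - k"] False k by auto
          also have "\<dots> \<le> (\<Sum>k<n. \<bar>b k\<bar>)" using False k by (intro sum_mono2) auto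
          finally show ?thesis using pnn[of k]
            by (auto simp: abs_mult intro: mult_left_mono)
        qed (simp add: p0)
      qed
      also have "\<dots> \<le> 1 * (\<Sum>k<n. \<bar>b k\<bar>)"
        unfolding sum_distrib_right[symmetric] by (intro mult_right_mono partial_le sum_nonneg) auto
      finally have "\<bar>\<Sum>k\<le>n. p k * u (n - k)\<bar> \<le> (\<Sum>k<n. \<bar>b k\<bar>)" by simp
      moreover have "u n = b n + (\<Sum>k\<le>n. p k * u (n - k))"
        using assms unfolding solution_def by blast
      moreover have "(\<Sum>k\<le>n. \<bar>b k\<bar>) = (\<Sum>k<n. \<bar>b k\<bar>) + \<bar>b n\<bar>"
        by (metis lessThan_Suc_atMost sum.lessThan_Suc)
      ultimately show ?thesis by linarith
    next
      case True
      have "u 0 = b 0 + (\<Sum>k\<le>0. p k * u (0 - k))" using assms unfolding solution_def by blast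
      then have "u 0 = b 0" by (simp add: p0)
      then show ?thesis using True by simp
    qed
  qed
  also have "\<dots> \<le> (\<Sum>k. \<bar>b k\<bar>)"
    using assms by (intro sum_le_suminf) (auto simp: solution_def)
  finally show ?thesis .
qed

text \<open>A summed form of the renewal equation: as
  \<open>tail (Suc k) = tail k - p (Suc k)\<close>, passing from \<open>n\<close> to
  \<open>Suc n\<close> changes the left side by exactly \<open>b (Suc n)\<close>. If
  \<open>u\<close> is nearly constant on a long window, this reads mean times constant = sum of
  \<open>b\<close>.\<close>

lemma tail_convolution:
  assumes "solution b u" shows "(\<Sum>k\<le>n. tail k * u (n - k)) = (\<Sum>k\<le>n. b k)"
proof (induction n)
  case 0
  have "u 0 = b 0 + (\<Sum>k\<le>0. p k * u (0 - k))" using assms unfolding solution_def by blast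
  then show ?case by (simp add: tail_def p0)
next
  case (Suc n)
  have tS: "tail (Suc k) = tail k - p (Suc k)" for k by (simp add: tail_def)
  have "u (Suc n) = b (Suc n) + (\<Sum>k\<le>Suc n. p k * u (Suc n - k))"
    using assms unfolding solution_def by blast
  then have u: "u (Suc n) = b (Suc n) + (\<Sum>k\<le>n. p (Suc k) * u (n - k))"
    by (simp add: p0 sum.atMost_Suc_shift del: sum.atMost_Suc)
  have "(\<Sum>k\<le>Suc n. tail k * u (Suc n - k)) = u (Suc n) + (\<Sum>k\<le>n. tail (Suc k) * u (n - k))"
    by (simp add: sum.atMost_Suc_shift tail_def p0 del: sum.atMost_Suc)
  also have "\<dots> = b (Suc n) + (\<Sum>k\<le>n. tail k * u (n - k))"
    unfolding tS u by (simp add: left_diff_distrib sum_subtractf)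
  finally show ?case using Suc by simp
qed

text \<open>If \<open>u\<close> tends to its limit superior \<open>L\<close> along \<open>N\<close>, the renewal equation expresses \<open>u (N n)\<close> as an
  average of terms that are asymptotically at most \<open>L\<close>, so all of them with positive weight tend
  to \<open>L\<close>.  By aperiodicity this holds for all large shifts, and the identity
  \<open>tail_convolution\<close> then determines \<open>L\<close>.\<close>

lemma shift_limit:
  assumes u: "solution b u" and w: "(\<lambda>n. max 0 (u n - L)) \<longlonglongrightarrow> 0"
    and N: "filterlim N at_top sequentially" and lim: "(\<lambda>n. u (N n)) \<longlonglongrightarrow> L" and k: "0 < p k"
  shows "(\<lambda>n. u (N n - k)) \<longlonglongrightarrow> L"
proof -
  define w where "w = (\<lambda>n. max 0 (u n - L))"
  have w: "w \<longlonglongrightarrow> 0" using w unfolding w_def .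
  have Nk: "filterlim (\<lambda>n. N n - k) at_top sequentially" for k
    using N filterlim_compose[OF filterlim_minus_const_nat_at_top] by blast
  \<comment> \<open>By the renewal equation, \<open>up n\<close> is the sum of
    \<open>p j * (L + w (N n - j) - u (N n - j))\<close> over j \<le> N n. Adding the excess
    \<open>w\<close> makes every summand non-negative, so the one with j = k is at most
    \<open>up n\<close>, which tends to 0.\<close>
  define up where "up = (\<lambda>n. L * (\<Sum>j\<le>N n. p j) + (\<Sum>j\<le>N n. p j * w (N n - j)) + b (N n) - u (N n))"
  have "(\<lambda>n. \<Sum>j\<le>n. p j) \<longlonglongrightarrow> 1"
    using psum by (simp add: sums_def_le)
  then have "(\<lambda>n. \<Sum>j\<le>N n. p j) \<longlonglongrightarrow> 1" using N by (rule filterlim_compose)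
  moreover have "(\<lambda>n. \<Sum>j\<le>N n. p j * w (N n - j)) \<longlonglongrightarrow> 0"
    using filterlim_compose[OF convolution_tendsto[of p, OF pnn _ w] N] psum by (simp add: sums_iff)
  moreover have "(\<lambda>n. b (N n)) \<longlonglongrightarrow> 0"
  proof -
    have "summable b" using u summable_rabs_cancel[of b] unfolding solution_def by blast
    then show ?thesis by (rule filterlim_compose[OF summable_LIMSEQ_zero N])
  qed
  ultimately have "up \<longlonglongrightarrow> L * 1 + 0 + 0 - L"
    unfolding up_def by (intro tendsto_intros lim)
  then have up: "(\<lambda>n. up n / p k) \<longlonglongrightarrow> 0" using tendsto_divide_zero by simp
  have low: "(\<lambda>n. - w (N n - k)) \<longlonglongrightarrow> 0"
    using filterlim_compose[OF w Nk] tendsto_minus by fastforce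
  have "(\<lambda>n. L - u (N n - k)) \<longlonglongrightarrow> 0"
  proof (rule tendsto_sandwich[OF _ _ low up])
    show "\<forall>\<^sub>F n in sequentially. - w (N n - k) \<le> L - u (N n - k)"
      by (intro always_eventually) (auto simp: w_def)
    have "\<forall>\<^sub>F n in sequentially. k \<le> N n" using N by (auto simp: filterlim_at_top)
    then show "\<forall>\<^sub>F n in sequentially. L - u (N n - k) \<le> up n / p k"
    proof eventually_elim
      case (elim n)
      have "p k * (L - u (N n - k)) \<le> p k * (L + w (N n - k) - u (N n - k))"
        using k by (intro mult_left_mono) (auto simp: w_def)
      also have "\<dots> \<le> (\<Sum>j\<le>N n. p j * (L + w (N n - j) - u (N n - j)))"
        using elim pnn by (intro member_le_sum[of k "{..N n}" "\<lambda>j. p j * (L + w (N n - j) - u (N n - j))"])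
          (auto simp: w_def intro!: mult_nonneg_nonneg)
      also have "\<dots> = L * (\<Sum>j\<le>N n. p j) + (\<Sum>j\<le>N n. p j * w (N n - j)) - (\<Sum>j\<le>N n. p j * u (N n - j))"
        by (simp add: algebra_simps sum.distrib sum_subtractf sum_distrib_left)
      also have "\<dots> = up n"
      proof -
        have "u (N n) = b (N n) + (\<Sum>k\<le>N n. p k * u (N n - k))"
          using u unfolding solution_def by blast
        then show ?thesis unfolding up_def by linarith
      qed
      finally show ?case using k by (simp add: field_simps)
    qed
  qed
  then have "(\<lambda>n. L - (L - u (N n - k))) \<longlonglongrightarrow> L - 0" by (intro tendsto_diff) auto
  then show ?thesis by simp
qed

lemma limit_from_above:
  assumes u: "solution b u"
  shows "(\<lambda>n. max 0 (u n - (\<Sum>n. b n) / (\<Sum>n. real n * p n))) \<longlonglongrightarrow> 0"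
proof -
  let ?B = "\<Sum>k. \<bar>b k\<bar>"
  define U where "U = (\<lambda>n. ereal (u n))"
  obtain N where N: "strict_mono N" and lim: "(U \<circ> N) \<longlonglongrightarrow> limsup U"
    using limsup_subseq_lim by blast
  have b: "- ?B \<le> u n" "u n \<le> ?B" for n using solution_bounded[OF u, of n] by auto
  have "limsup U \<le> ereal ?B" "ereal (- ?B) \<le> limsup U"
    using b by (auto simp: U_def intro!: Limsup_bounded le_Limsup always_eventually)
  then obtain L where L: "limsup U = ereal L" by (cases "limsup U") auto
  have limu: "(\<lambda>n. u (N n)) \<longlonglongrightarrow> L" using lim unfolding L unfolding U_def o_def by simp
  have w: "(\<lambda>n. max 0 (u n - L)) \<longlonglongrightarrow> 0"
  proof (rule LIMSEQ_I)
    fix r :: real assume "0 < r"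
    then have "limsup U < ereal (L + r)" unfolding L by simp
    from Limsup_lessD[OF this] have "\<forall>\<^sub>F n in sequentially. u n < L + r" by (simp add: U_def)
    then obtain M where "\<forall>n\<ge>M. u n < L + r" by (auto simp: eventually_sequentially)
    then show "\<exists>no. \<forall>n\<ge>no. norm (max 0 (u n - L) - 0) < r"
      using \<open>0 < r\<close> by (intro exI[of _ M]) (auto simp: max_def)
  qed
  have Nlim: "filterlim N at_top sequentially" using N by (rule filterlim_subseq)
  \<comment> \<open>Quantifying over all sequences \<open>N\<close>, not just the one found above,
    makes \<open>A\<close> closed under addition: after a shift by a, the sequence
    \<open>N n - a\<close> again qualifies.\<close>
  define A where "A = {k. \<forall>N. filterlim N at_top sequentially \<longrightarrow> (\<lambda>n. u (N n)) \<longlonglongrightarrow> L \<longrightarrow>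
    (\<lambda>n. u (N n - k)) \<longlonglongrightarrow> L}"
  have Nk: "filterlim (\<lambda>n. N n - k) at_top sequentially" if "filterlim N at_top sequentially" for k and N :: "nat \<Rightarrow> nat"
    using that filterlim_compose[OF filterlim_minus_const_nat_at_top] by blast
  have supp: "{n. 0 < p n} \<subseteq> A" using shift_limit[OF u w] unfolding A_def by blast
  have "Gcd A dvd k" if "0 < p k" for k using supp that by (intro Gcd_dvd) auto
  then have "Gcd A dvd Gcd {n. 0 < p n}" by (intro Gcd_greatest) auto
  then have "Gcd A = 1" using gcd by simp
  moreover have "a + b \<in> A" if "a \<in> A" "b \<in> A" for a b
    unfolding A_def
  proof (intro CollectI allI impI)
    fix N :: "nat \<Rightarrow> nat" assume *: "filterlim N at_top sequentially" "(\<lambda>n. u (N n)) \<longlonglongrightarrow> L"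
    then have "(\<lambda>n. u (N n - a)) \<longlonglongrightarrow> L" using that(1) unfolding A_def by blast
    then have "(\<lambda>n. u (N n - a - b)) \<longlonglongrightarrow> L" using that(2) Nk[OF *(1)] unfolding A_def by blast
    then show "(\<lambda>n. u (N n - (a + b))) \<longlonglongrightarrow> L" by simp
  qed
  moreover have "0 \<in> A" unfolding A_def by simp
  ultimately obtain K where K: "\<And>n. K \<le> n \<Longrightarrow> n \<in> A"
    using additive_set_contains_all_large[of A] by blast
  \<comment> \<open>Starting K steps earlier, every shift k \<ge> 0 of \<open>N'\<close> is a shift
    of \<open>N\<close> by K + k and hence lies in \<open>A\<close>.\<close>
  define N' where "N' = (\<lambda>n. N n - K)"
  have N': "filterlim N' at_top sequentially" unfolding N'_def by (rule Nk[OF Nlim])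
  have "(\<lambda>n. u (N' n - k)) \<longlonglongrightarrow> L" for k
    using K[of "K + k"] Nlim limu unfolding A_def N'_def by simp
  from convolution_tendsto_along[of tail u, OF tail_nonneg _ solution_bounded[OF u] N' this]
  have "(\<lambda>n. \<Sum>k\<le>N' n. b k) \<longlonglongrightarrow> (\<Sum>n. real n * p n) * L"
    using tail_sums unfolding tail_convolution[OF u] by (simp add: sums_iff)
  moreover have "(\<lambda>n. \<Sum>k\<le>n. b k) \<longlonglongrightarrow> (\<Sum>n. b n)"
    using u summable_rabs_cancel[of b] summable_LIMSEQ' unfolding solution_def by blast
  then have "(\<lambda>n. \<Sum>k\<le>N' n. b k) \<longlonglongrightarrow> (\<Sum>n. b n)"
    using N' by (rule filterlim_compose)
  ultimately have eq: "(\<Sum>n. b n) = (\<Sum>n. real n * p n) * L" by (rule LIMSEQ_unique[rotated])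
  with mean_pos have "L = (\<Sum>n. b n) / (\<Sum>n. real n * p n)" by simp
  then show ?thesis using w by simp
qed

theorem renewal_theorem:
  assumes u: "solution b u"
  shows "u \<longlonglongrightarrow> (\<Sum>n. b n) / (\<Sum>n. real n * p n)"
proof -
  let ?c = "(\<Sum>n. b n) / (\<Sum>n. real n * p n)"
  have "summable b" using u summable_rabs_cancel[of b] unfolding solution_def by blast
  then have sb: "(\<Sum>n. - b n) = - (\<Sum>n. b n)" by (rule suminf_minus)
  have "- u n = - b n + (\<Sum>k\<le>n. p k * - u (n - k))" for n
  proof -
    have "u n = b n + (\<Sum>k\<le>n. p k * u (n - k))" using u unfolding solution_def by blast
    then show ?thesis by (simp add: sum_negf)
  qed
  moreover have "summable (\<lambda>n. \<bar>- b n\<bar>)" using u unfolding solution_def by simp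
  ultimately have "solution (\<lambda>n. - b n) (\<lambda>n. - u n)" unfolding solution_def by blast
  from limit_from_above[OF this] have "(\<lambda>n. max 0 (?c - u n)) \<longlonglongrightarrow> 0" by (simp add: sb)
  from tendsto_diff[OF limit_from_above[OF u] this]
  have "(\<lambda>n. u n - ?c) \<longlonglongrightarrow> 0" 
    by (rule tendsto_eq_rhs[OF tendsto_cong[THEN iffD1, rotated]]) (auto simp: max_def intro!: always_eventually)
  then show ?thesis by (simp add: LIM_zero_iff)
qed

end

section \<open>Convergence of generating functions\<close>

text \<open>Each value x > c is damped at least by the factor (c / (c + 1))^a. The value x = 0 is
  invisible on both sides, as division by 0 gives 0 and a is positive.\<close>

lemma expectation_dirichlet_remainder:
  fixes p :: "nat pmf" and c a :: nat
  assumes c: "0 < c" and a: "0 < a"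
  shows "\<bar>measure_pmf.expectation p (\<lambda>x. (real c / real x) ^ a) - (\<Sum>x\<le>c. pmf p x * (real c / real x) ^ a)\<bar>
    \<le> (real c / real (Suc c)) ^ a"
proof -
  let ?\<phi> = "\<lambda>x. (real c / real x) ^ a"
  have le1: "real c / real x \<le> real c" for x
    by (cases "x = 0") (use c in \<open>auto simp: field_simps\<close>)
  have bnd: "\<bar>?\<phi> x\<bar> \<le> real c ^ a" for x
    using le1[of x] by (simp add: power_abs[symmetric] del: power_abs) (intro power_mono, auto)
  have int: "integrable (measure_pmf p) (\<lambda>x. ?\<phi> x * indicator A x)" for A
    by (rule measure_pmf.integrable_const_bound[where B = "real c ^ a"])
       (use bnd in \<open>auto simp: indicator_def simp del: power_divide\<close>)
  have "(\<Sum>x\<le>c. pmf p x * ?\<phi> x) = measure_pmf.expectation p (\<lambda>x. ?\<phi> x * indicator {..c} x)"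
    by (subst integral_measure_pmf[of "{..c}"]) (auto simp: indicator_def simp del: power_divide)
  moreover have "measure_pmf.expectation p ?\<phi> = measure_pmf.expectation p (\<lambda>x. ?\<phi> x * indicator {..c} x)
      + measure_pmf.expectation p (\<lambda>x. ?\<phi> x * indicator {c<..} x)"
    by (subst Bochner_Integration.integral_add[symmetric, OF int int])
       (intro Bochner_Integration.integral_cong, auto simp: indicator_def)
  moreover have "0 \<le> measure_pmf.expectation p (\<lambda>x. ?\<phi> x * indicator {c<..} x)"
    by (intro integral_nonneg_AE always_eventually) auto
  moreover have "measure_pmf.expectation p (\<lambda>x. ?\<phi> x * indicator {c<..} x)
      \<le> measure_pmf.expectation p (\<lambda>x. (real c / real (Suc c)) ^ a)"
  proof (intro integral_mono int)
    fix x
    show "?\<phi> x * indicator {c<..} x \<le> (real c / real (Suc c)) ^ a"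
    proof (cases "c < x")
      case True
      then have "real c / real x \<le> real c / real (Suc c)" by (intro divide_left_mono) auto
      then have "?\<phi> x \<le> (real c / real (Suc c)) ^ a" by (intro power_mono) auto
      then show ?thesis using True by simp
    qed (auto intro: zero_le_power)
  qed auto
  ultimately show ?thesis by simp
qed

text \<open>Strong induction on \<open>c\<close>. After scaling by c^a, the masses below
  \<open>c\<close>, whose limits are already known, are subtracted; what is left is
  \<open>pmf p c\<close> up to an error that vanishes as a grows, uniformly in the law
  \<open>p\<close>. Therefore a can be fixed before n tends to infinity.\<close>

lemma pmf_tendsto_of_dirichlet:
  fixes q :: "nat \<Rightarrow> nat pmf" and Y :: "nat pmf"
  assumes lim: "\<And>a. 0 < a \<Longrightarrow> (\<lambda>n. measure_pmf.expectation (q n) (\<lambda>x. inverse (real x) ^ a))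
      \<longlonglongrightarrow> measure_pmf.expectation Y (\<lambda>x. inverse (real x) ^ a)"
    and c: "0 < c"
  shows "(\<lambda>n. pmf (q n) c) \<longlonglongrightarrow> pmf Y c"
  using c
proof (induction c rule: less_induct)
  case (less c)
  let ?\<phi> = "\<lambda>a x. (real c / real x) ^ a"
  define S where "S = (\<lambda>a p. measure_pmf.expectation p (?\<phi> a) - (\<Sum>x<c. pmf p x * ?\<phi> a x))"
  have S: "(\<lambda>n. S a (q n)) \<longlonglongrightarrow> S a Y" if "0 < a" for a
  proof -
    have "measure_pmf.expectation p (?\<phi> a) = real c ^ a * measure_pmf.expectation p (\<lambda>x. inverse (real x) ^ a)" for p
      by (simp add: divide_inverse power_mult_distrib)
    moreover have "(\<lambda>n. pmf (q n) x * ?\<phi> a x) \<longlonglongrightarrow> pmf Y x * ?\<phi> a x" if "x < c" for x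
    proof (cases "x = 0")
      case False
      then show ?thesis using less.IH[of x] that by (intro tendsto_mult_right) auto
    qed (use \<open>0 < a\<close> in \<open>simp add: power_0_left\<close>)
    ultimately show ?thesis unfolding S_def using lim[OF that]
      by (auto intro!: tendsto_diff tendsto_sum tendsto_mult_left)
  qed
  have rem: "\<bar>S a p - pmf p c\<bar> \<le> (real c / real (Suc c)) ^ a" if "0 < a" for a p
  proof -
    have "(\<Sum>x\<le>c. pmf p x * ?\<phi> a x) = (\<Sum>x<c. pmf p x * ?\<phi> a x) + pmf p c"
      using less.prems by (simp add: lessThan_Suc_atMost[symmetric])
    then show ?thesis using expectation_dirichlet_remainder[of c a p] less.prems that
      unfolding S_def by simp
  qed
  show ?case
  proof (rule LIMSEQ_I)
    fix r :: real assume r: "0 < r"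
    have "(\<lambda>a. (real c / real (Suc c)) ^ a) \<longlonglongrightarrow> 0"
      by (intro LIMSEQ_realpow_zero) auto
    then have "\<forall>\<^sub>F a in sequentially. (real c / real (Suc c)) ^ a < r / 3"
      using r by (intro order_tendstoD(2)) auto
    then obtain a where a: "0 < a" "(real c / real (Suc c)) ^ a < r / 3"
      by (metis (lifting) eventually_sequentially le_add2 less_Suc_eq_0_disj less_Suc_eq_le plus_1_eq_Suc zero_less_Suc)
    from LIMSEQ_D[OF S[OF a(1)], of "r / 3"] r
    obtain n0 where n0: "\<And>n. n0 \<le> n \<Longrightarrow> \<bar>S a (q n) - S a Y\<bar> < r / 3" by auto
    have "\<bar>pmf (q n) c - pmf Y c\<bar> < r" if "n0 \<le> n" for n
      using n0[OF that] rem[OF a(1), of "q n"] rem[OF a(1), of Y] a(2) by linarith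
    then show "\<exists>no. \<forall>n\<ge>no. norm (pmf (q n) c - pmf Y c) < r" by auto
  qed
qed

text \<open>At \<open>s\<^sub>i = p\<^sub>i\<^sup>-\<^sup>a\<close>, with \<open>p\<^sub>i\<close> the \<open>i\<close>-th prime, a generating function becomes a Dirichlet series in
  \<open>a\<close>, and unique factorization lets its coefficients be recovered one at a time.\<close>

definition prime_code :: "nat multiset \<Rightarrow> nat" where
  "prime_code x = (\<Prod>i\<in>#x. enumerate {p. prime p} i)"

lemma prime_enumerate: "prime (enumerate {p::nat. prime p} i)"
  using enumerate_in_set[OF primes_infinite] by blast

lemma prime_code_pos: "0 < prime_code x"
  unfolding prime_code_def using prime_enumerate prime_gt_0_nat
  by (metis (no_types, lifting) bot_nat_0.not_eq_extremum image_iff prod_mset_zero_iff set_image_mset)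

lemma inj_prime_code: "inj prime_code"
proof (rule injI)
  fix x y assume eq: "prime_code x = prime_code y"
  have "prime_factorization (prime_code x) = image_mset (enumerate {p. prime p}) x" for x
    unfolding prime_code_def by (intro prime_factorization_prod_mset_primes) (auto intro: prime_enumerate)
  with eq have "image_mset (enumerate {p::nat. prime p}) x = image_mset (enumerate {p. prime p}) y"
    by metis
  moreover have "inj (enumerate {p::nat. prime p})"
    using strict_mono_enumerate[OF primes_infinite] strict_mono_imp_inj_on by blast
  ultimately show "x = y" by (metis multiset.inj_map injD)
qed

lemma pmf_tendsto_of_pgf:
  fixes q :: "nat \<Rightarrow> nat multiset pmf" and Y :: "nat multiset pmf"
  assumes lim: "\<And>s :: nat \<Rightarrow> real. (\<forall>i. 0 \<le> s i \<and> s i \<le> 1) \<Longrightarrow> (\<lambda>n. measure_pmf.expectation (q n) (\<lambda>x. \<Prod>i\<in>#x. s i))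
      \<longlonglongrightarrow> measure_pmf.expectation Y (\<lambda>x. \<Prod>i\<in>#x. s i)"
  shows "(\<lambda>n. pmf (q n) k) \<longlonglongrightarrow> pmf Y k"
proof -
  have "(\<lambda>n. pmf (map_pmf prime_code (q n)) (prime_code k)) \<longlonglongrightarrow> pmf (map_pmf prime_code Y) (prime_code k)"
  proof (rule pmf_tendsto_of_dirichlet[OF _ prime_code_pos])
    fix a :: nat assume "0 < a"
    let ?s = "\<lambda>i. inverse (real (enumerate {p. prime p} i)) ^ a"
    have s: "(\<Prod>i\<in>#x. ?s i) = inverse (real (prime_code x)) ^ a" for x
      by (induction x) (auto simp: prime_code_def power_mult_distrib)
    have "\<forall>i. 0 \<le> ?s i \<and> ?s i \<le> 1"
      using prime_enumerate prime_gt_0_nat by (auto intro!: power_le_one inverse_le_1_iff[THEN iffD2] simp: Suc_le_eq)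
    from lim[OF this] show "(\<lambda>n. measure_pmf.expectation (map_pmf prime_code (q n)) (\<lambda>x. inverse (real x) ^ a))
      \<longlonglongrightarrow> measure_pmf.expectation (map_pmf prime_code Y) (\<lambda>x. inverse (real x) ^ a)"
      by (simp add: s)
  qed
  then show ?thesis by (simp add: pmf_map_inj'[OF inj_prime_code])
qed

section \<open>Laws of the generations\<close>

lemma countable_multisets: "countable (UNIV :: nat multiset set)"
  using inj_prime_code by (rule countableI)

definition pgf :: "nat multiset pmf \<Rightarrow> (nat \<Rightarrow> real) \<Rightarrow> real" where
  "pgf q s = measure_pmf.expectation q (\<lambda>x. \<Prod>i\<in>#x. s i)"

text \<open>The unit cube, on which generating functions are evaluated; not the unit vectors, which
  appear below as \<open>unit_col\<close>.\<close>

definition unit_vec :: "(nat \<Rightarrow> real) \<Rightarrow> bool" where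
  "unit_vec s \<longleftrightarrow> (\<forall>i. 0 \<le> s i \<and> s i \<le> 1)"

lemma prod_mset_unit:
  assumes "unit_vec s"
  shows "0 \<le> (\<Prod>i\<in>#x. s i)" and "(\<Prod>i\<in>#x. s i) \<le> 1"
  using assms by (induction x) (auto simp: unit_vec_def intro: mult_le_one)

lemma integrable_unit:
  fixes f :: "'a \<Rightarrow> real"
  assumes "\<And>x. 0 \<le> f x" "\<And>x. f x \<le> 1"
  shows "integrable (measure_pmf q) f"
  by (rule measure_pmf.integrable_const_bound[where B = 1]) (use assms in auto)

lemma pgf_unit:
  assumes "unit_vec s" shows "0 \<le> pgf q s" and "pgf q s \<le> 1"
proof -
  show "0 \<le> pgf q s" unfolding pgf_def by (intro integral_nonneg_AE always_eventually allI prod_mset_unit assms)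
  have "pgf q s \<le> measure_pmf.expectation q (\<lambda>x. 1)"
    unfolding pgf_def by (intro integral_mono integrable_unit prod_mset_unit assms) auto
  then show "pgf q s \<le> 1" by simp
qed

lemma expectation_bind_pmf:
  fixes f :: "'b \<Rightarrow> real"
  assumes f: "\<And>x. 0 \<le> f x" "\<And>x. f x \<le> 1"
  shows "measure_pmf.expectation (bind_pmf q K) f = measure_pmf.expectation q (\<lambda>x. measure_pmf.expectation (K x) f)"
proof -
  have "ennreal (measure_pmf.expectation (bind_pmf q K) f) = (\<integral>\<^sup>+y. ennreal (f y) \<partial>bind_pmf q K)"
    by (intro nn_integral_eq_integral[symmetric] integrable_unit f) (auto simp: f)
  also have "\<dots> = (\<integral>\<^sup>+x. \<integral>\<^sup>+y. ennreal (f y) \<partial>K x \<partial>q)" by simp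
  also have "\<dots> = (\<integral>\<^sup>+x. ennreal (measure_pmf.expectation (K x) f) \<partial>q)"
    by (intro nn_integral_cong nn_integral_eq_integral integrable_unit f) (auto simp: f)
  also have "\<dots> = ennreal (measure_pmf.expectation q (\<lambda>x. measure_pmf.expectation (K x) f))"
  proof (intro nn_integral_eq_integral integrable_unit)
    fix x
    show "0 \<le> measure_pmf.expectation (K x) f" by (intro integral_nonneg_AE always_eventually allI f)
    have "measure_pmf.expectation (K x) f \<le> measure_pmf.expectation (K x) (\<lambda>x. 1)"
      by (intro integral_mono integrable_unit f) auto
    then show "measure_pmf.expectation (K x) f \<le> 1" by simp
  qed (auto intro!: integral_nonneg_AE simp: f)
  finally show ?thesis
    by (subst (asm) ennreal_inj) (auto intro!: integral_nonneg_AE simp: f)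
qed

lemma pgf_next_generation:
  assumes s: "unit_vec s"
  shows "pgf (next_generation p x) s = (\<Prod>j\<in>#x. pgf (p j) s)"
proof -
  let ?A = "SIGMA j:set_mset x. {..<count x j}"
  have fin: "finite ?A" by auto
  have prod_sum: "(\<Prod>i\<in>#(\<Sum>a\<in>B. Y a). s i) = (\<Prod>a\<in>B. \<Prod>i\<in>#Y a. s i)"
    for Y :: "nat \<times> nat \<Rightarrow> nat multiset" and B
    by (induction B rule: infinite_finite_induct) auto
  have "pgf (next_generation p x) s
      = measure_pmf.expectation (Pi_pmf ?A {#} (\<lambda>(j, l). p j)) (\<lambda>Y. \<Prod>a\<in>?A. \<Prod>i\<in>#Y a. s i)"
    unfolding pgf_def next_generation_def Let_def by (simp add: prod_sum)
  also have "\<dots> = (\<Prod>a\<in>?A. measure_pmf.expectation ((\<lambda>(j, l). p j) a) (\<lambda>y. \<Prod>i\<in>#y. s i))"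
    by (intro expectation_prod_Pi_pmf fin integrable_unit prod_mset_unit s)
  also have "\<dots> = (\<Prod>j\<in>set_mset x. \<Prod>l<count x j. pgf (p j) s)"
    by (subst prod.Sigma) (auto simp: pgf_def intro!: prod.cong)
  also have "\<dots> = (\<Prod>j\<in>#x. pgf (p j) s)"
    by (simp add: image_prod_mset_multiplicity)
  finally show ?thesis .
qed

primrec gen_law :: "(nat \<Rightarrow> nat multiset pmf) \<Rightarrow> nat \<Rightarrow> nat \<Rightarrow> nat multiset pmf" where
  "gen_law p i 0 = return_pmf {#i#}"
| "gen_law p i (Suc n) = bind_pmf (gen_law p i n) (next_generation p)"

lemma pgf_gen_law_Suc:
  assumes "unit_vec s"
  shows "pgf (gen_law p i (Suc n)) s = pgf (gen_law p i n) (\<lambda>j. pgf (p j) s)"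
proof -
  have "pgf (gen_law p i (Suc n)) s = measure_pmf.expectation (gen_law p i n) (\<lambda>x. pgf (next_generation p x) s)"
    unfolding pgf_def gen_law.simps by (intro expectation_bind_pmf prod_mset_unit assms)
  then show ?thesis unfolding pgf_next_generation[OF assms] by (simp only: pgf_def)
qed

section \<open>From finite-dimensional distributions to the law of one generation\<close>

primrec path_law :: "(nat \<Rightarrow> nat multiset pmf) \<Rightarrow> nat \<Rightarrow> nat \<Rightarrow> nat multiset list pmf" where
  "path_law p i 0 = return_pmf [{#i#}]"
| "path_law p i (Suc n) = bind_pmf (path_law p i n) (\<lambda>xs. map_pmf (\<lambda>y. xs @ [y]) (next_generation p (last xs)))"

lemma map_last_path_law: "map_pmf last (path_law p i n) = gen_law p i n"
proof (induction n)
  case (Suc n)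
  have "map_pmf last (path_law p i (Suc n)) = bind_pmf (path_law p i n) (\<lambda>xs. next_generation p (last xs))"
    by (simp add: map_bind_pmf pmf.map_comp o_def)
  also have "\<dots> = bind_pmf (map_pmf last (path_law p i n)) (next_generation p)"
    by (simp add: bind_map_pmf)
  finally show ?case using Suc by simp
qed simp

lemma length_path_law: "xs \<in> set_pmf (path_law p i n) \<Longrightarrow> length xs = Suc n"
  by (induction n arbitrary: xs) auto

lemma pmf_path_law_Suc:
  assumes "xs \<noteq> []"
  shows "pmf (path_law p i (Suc n)) (xs @ [y]) = pmf (path_law p i n) xs * pmf (next_generation p (last xs)) y"
proof -
  have "pmf (map_pmf (\<lambda>y. ys @ [y]) (next_generation p (last ys))) (xs @ [y])
      = indicator {xs} ys * pmf (next_generation p (last xs)) y" for ys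
  proof (cases "ys = xs")
    case True
    have "inj (\<lambda>y. xs @ [y])" by (auto intro: injI)
    from pmf_map_inj'[OF this] True show ?thesis by simp
  next
    case False
    then have "xs @ [y] \<notin> set_pmf (map_pmf (\<lambda>y. ys @ [y]) (next_generation p (last ys)))" by auto
    then have "pmf (map_pmf (\<lambda>y. ys @ [y]) (next_generation p (last ys))) (xs @ [y]) = 0"
      by (rule pmf_eq_0_set_pmf[THEN iffD2])
    then show ?thesis using False by simp
  qed
  then show ?thesis
    by (simp add: pmf_bind measure_pmf_single)
qed

text \<open>The process is specified only through probabilities of whole histories. So the history
  up to time n, as a list, is first shown to have law \<open>path_law\<close>, which obeys the same
  recursion; there are countably many lists, so point masses determine this law. The law of
  \<open>Z n\<close> is its image under \<open>last\<close>.\<close>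

lemma BGW_process_law:
  assumes "BGW_process p i P Z"
  shows "distr P (count_space UNIV) (Z n) = measure_pmf (gen_law p i n)"
proof -
  interpret prob_space P using assms by (simp add: BGW_process_def)
  have Z[measurable]: "Z n \<in> measurable P (count_space UNIV)" for n
    using assms by (simp add: BGW_process_def)
  have Z0: "AE \<omega> in P. Z 0 \<omega> = {#i#}" using assms by (simp add: BGW_process_def)
  have step: "\<P>(\<omega> in P. \<forall>t\<le>Suc n. Z t \<omega> = x t)
     = \<P>(\<omega> in P. \<forall>t\<le>n. Z t \<omega> = x t) * pmf (next_generation p (x n)) (x (Suc n))" for n x
    using assms unfolding BGW_process_def by blast
  have path: "\<P>(\<omega> in P. \<forall>t\<le>n. Z t \<omega> = xs ! t) = pmf (path_law p i n) xs" if "length xs = Suc n" for n xs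
    using that
  proof (induction n arbitrary: xs)
    case 0
    then obtain x where xs: "xs = [x]" by (metis length_0_conv length_Suc_conv)
    have "\<P>(\<omega> in P. Z 0 \<omega> = x) = \<P>(\<omega> in P. {#i#} = x)"
      using Z0 by (intro finite_measure_eq_AE) auto
    then show ?case using prob_space by (auto simp: xs indicator_def)
  next
    case (Suc n)
    then obtain ys y where xs: "xs = ys @ [y]" and ys: "length ys = Suc n"
      by (metis length_Suc_conv_rev)
    have "\<P>(\<omega> in P. \<forall>t\<le>n. Z t \<omega> = xs ! t) = \<P>(\<omega> in P. \<forall>t\<le>n. Z t \<omega> = ys ! t)"
      using ys by (intro arg_cong[where f = "measure P"]) (auto simp: xs nth_append)
    moreover have "xs ! n = last ys" using ys by (simp add: xs nth_append last_conv_nth flip: length_greater_0_conv)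
    moreover have "xs ! Suc n = y" using ys by (simp add: xs nth_append)
    moreover have "ys \<noteq> []" using ys by auto
    ultimately show ?case using step[of n "\<lambda>t. xs ! t"] Suc.IH[OF ys] by (simp add: xs pmf_path_law_Suc del: path_law.simps)
  qed
  define W where "W = (\<lambda>\<omega>. map (\<lambda>t. Z t \<omega>) [0..<Suc n])"
  have eqW: "W -` {xs} \<inter> space P = (if length xs = Suc n then {\<omega>\<in>space P. \<forall>t\<le>n. Z t \<omega> = xs ! t} else {})" for xs
  proof -
    have "W \<omega> = xs \<longleftrightarrow> length xs = Suc n \<and> (\<forall>t\<le>n. Z t \<omega> = xs ! t)" for \<omega>
    proof -
      have "W \<omega> = xs \<longleftrightarrow> length (W \<omega>) = length xs \<and> (\<forall>t<length (W \<omega>). W \<omega> ! t = xs ! t)"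
        by (rule list_eq_iff_nth_eq)
      moreover have "length (W \<omega>) = Suc n" by (simp add: W_def)
      moreover have "W \<omega> ! t = Z t \<omega>" if "t < Suc n" for t
        using that unfolding W_def by (simp del: upt_Suc)
      ultimately show ?thesis by (auto simp: less_Suc_eq_le)
    qed
    then show ?thesis by auto
  qed
  have cl: "countable (UNIV :: nat multiset list set)"
    using countable_lists[OF countable_multisets] by simp
  have W[measurable]: "W \<in> measurable P (count_space UNIV)"
    by (subst measurable_count_space_eq_countable[OF cl]) (auto simp: eqW)
  have "distr P (count_space UNIV) W = measure_pmf (path_law p i n)"
  proof (rule measure_eqI_countable[OF _ _ cl])
    fix xs
    have "emeasure (distr P (count_space UNIV) W) {xs} = ennreal (measure P (W -` {xs} \<inter> space P))"
      by (simp add: emeasure_distr emeasure_eq_measure)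
    also have "measure P (W -` {xs} \<inter> space P) = pmf (path_law p i n) xs"
    proof (cases "length xs = Suc n")
      case False
      then have "xs \<notin> set_pmf (path_law p i n)" using length_path_law by blast
      then show ?thesis using False by (simp add: eqW set_pmf_iff)
    qed (simp add: eqW path)
    finally show "emeasure (distr P (count_space UNIV) W) {xs} = emeasure (measure_pmf (path_law p i n)) {xs}"
      by (simp add: emeasure_pmf_single)
  qed auto
  then have "distr (distr P (count_space UNIV) W) (count_space UNIV) last
      = distr (measure_pmf (path_law p i n)) (count_space UNIV) last" by simp
  also have "\<dots> = measure_pmf (map_pmf last (path_law p i n))" by (simp add: map_pmf_rep_eq)
  also have "\<dots> = measure_pmf (gen_law p i n)" by (simp add: map_last_path_law)
  also have "distr (distr P (count_space UNIV) W) (count_space UNIV) last = distr P (count_space UNIV) (last \<circ> W)"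
    by (intro distr_distr) auto
  also have "last \<circ> W = Z n" by (auto simp: W_def)
  finally show ?thesis .
qed

section \<open>Construction of linear-fractional laws\<close>

lemma expectation_nat_pmf_sums:
  fixes f :: "nat \<Rightarrow> real"
  assumes f: "\<And>x. 0 \<le> f x" "\<And>x. f x \<le> 1"
  shows "(\<lambda>i. pmf p i * f i) sums measure_pmf.expectation p f"
proof -
  have "(\<Sum>i. ennreal (pmf p i * f i)) = (\<integral>\<^sup>+x. ennreal (f x) \<partial>measure_pmf p)"
    by (simp add: nn_integral_measure_pmf nn_integral_count_space_nat ennreal_mult' f)
  also have "\<dots> = ennreal (measure_pmf.expectation p f)"
    by (intro nn_integral_eq_integral integrable_unit f) (auto simp: f)
  finally have "(\<lambda>i. ennreal (pmf p i * f i)) sums ennreal (measure_pmf.expectation p f)"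
    by (metis summableI summable_sums)
  then show ?thesis
    by (subst (asm) sums_ennreal) (auto intro!: integral_nonneg_AE simp: f)
qed

lemma pmf_of_prob_vec:
  assumes "prob_vec h" obtains q where "\<And>i. pmf q i = h i"
proof
  have "(\<integral>\<^sup>+x. ennreal (h x) \<partial>count_space UNIV) = 1"
    using assms by (auto simp: nn_integral_count_space_nat prob_vec_def suminf_ennreal_eq sums_iff)
  then show "pmf (embed_pmf h) i = h i" for i
    using assms by (intro pmf_embed_pmf) (auto simp: prob_vec_def)
qed

lemma pgf_replicate_pmf:
  assumes s: "unit_vec s"
  shows "measure_pmf.expectation (replicate_pmf n q) (\<lambda>xs. \<Prod>i\<in>#mset xs. s i) = measure_pmf.expectation q s ^ n"
proof (induction n)
  case (Suc n)
  have *: "0 \<le> s x * (\<Prod>i\<in>#mset xs. s i)" "s x * (\<Prod>i\<in>#mset xs. s i) \<le> 1" for x xs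
    using prod_mset_unit[OF s, of "mset (x # xs)"] by simp_all
  have "measure_pmf.expectation (replicate_pmf (Suc n) q) (\<lambda>xs. \<Prod>i\<in>#mset xs. s i)
      = measure_pmf.expectation q (\<lambda>x. measure_pmf.expectation (replicate_pmf n q) (\<lambda>xs. s x * (\<Prod>i\<in>#mset xs. s i)))"
    unfolding replicate_pmf.simps
    by (subst expectation_bind_pmf, use prod_mset_unit[OF s] in auto)
       (subst map_pmf_def[symmetric], simp)
  also have "\<dots> = measure_pmf.expectation q (\<lambda>x. s x * measure_pmf.expectation q s ^ n)"
    using Suc by simp
  finally show ?case by simp
qed simp

text \<open>The law is that of one particle with type law \<open>h\<close> together with N
  independent particles with type law \<open>g\<close>, where N is geometric with success
  probability 1 / (1 + m), hence with mean m. There is always a first particle, which matches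
  \<open>h\<close> having full mass; this is the case met after conditioning on survival.\<close>

lemma LF_exists:
  assumes h: "prob_vec h" and g: "prob_vec g" and m: "0 < m"
  shows "\<exists>q. LF q h g m"
proof -
  obtain hp where hp: "\<And>i. pmf hp i = h i" using pmf_of_prob_vec[OF h] by blast
  obtain gp where gp: "\<And>i. pmf gp i = g i" using pmf_of_prob_vec[OF g] by blast
  define N where "N = geometric_pmf (1 / (1 + m))"
  define q where "q = bind_pmf hp (\<lambda>i. bind_pmf N (\<lambda>n. map_pmf (\<lambda>xs. add_mset i (mset xs)) (replicate_pmf n gp)))"
  have "pgf q s = (\<Sum>i. h i * s i) / (1 + m - m * (\<Sum>i. g i * s i))" if s: "unit_vec s" for s
  proof -
    have s': "0 \<le> s i" "s i \<le> 1" for i using s by (auto simp: unit_vec_def)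
    define \<gamma> where "\<gamma> = measure_pmf.expectation gp s"
    have \<gamma>: "\<gamma> = (\<Sum>i. g i * s i)"
      using expectation_nat_pmf_sums[of s gp, OF s'] by (simp add: \<gamma>_def gp sums_iff)
    have \<gamma>0: "0 \<le> \<gamma>" unfolding \<gamma>_def by (intro integral_nonneg_AE) (auto simp: s')
    have "\<gamma> \<le> measure_pmf.expectation gp (\<lambda>i. 1)" unfolding \<gamma>_def
      by (intro integral_mono integrable_unit s') auto
    then have \<gamma>1: "\<gamma> \<le> 1" by simp
    \<comment> \<open>The ratio of the geometric series for the generating function of N at
      \<gamma>.\<close>
    define r where "r = m / (1 + m) * \<gamma>"
    have r: "0 \<le> r" "r < 1"
    proof -
      have "r \<le> m / (1 + m) * 1" unfolding r_def using m \<gamma>1 by (intro mult_left_mono) auto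
      also have "\<dots> < 1" using m by simp
      finally show "r < 1" .
      show "0 \<le> r" unfolding r_def using m \<gamma>0 by simp
    qed
    have "(\<lambda>n. pmf N n * \<gamma> ^ n) sums measure_pmf.expectation N (\<lambda>n. \<gamma> ^ n)"
      by (intro expectation_nat_pmf_sums) (auto simp: \<gamma>0 \<gamma>1 power_le_one)
    moreover have "pmf N n * \<gamma> ^ n = 1 / (1 + m) * r ^ n" for n
    proof -
      have "1 - 1 / (1 + m) = m / (1 + m)" using m by (simp add: field_simps)
      then show ?thesis unfolding N_def r_def using m by (subst pmf_geometric) (simp_all only: power_mult_distrib, auto)
    qed
    moreover have "(\<lambda>n. 1 / (1 + m) * r ^ n) sums (1 / (1 + m) * (1 / (1 - r)))"
      by (intro sums_mult geometric_sums) (use r in auto)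
    ultimately have "measure_pmf.expectation N (\<lambda>n. \<gamma> ^ n) = 1 / (1 + m) * (1 / (1 - r))"
      using sums_unique2 by simp
    also have "\<dots> = 1 / (1 + m - m * \<gamma>)"
      using m r unfolding r_def by (simp add: field_simps)
    finally have EN: "measure_pmf.expectation N (\<lambda>n. \<gamma> ^ n) = 1 / (1 + m - m * \<gamma>)" .
    have "pgf q s = measure_pmf.expectation hp (\<lambda>i. measure_pmf.expectation N (\<lambda>n.
        measure_pmf.expectation (replicate_pmf n gp) (\<lambda>xs. s i * (\<Prod>i\<in>#mset xs. s i))))"
      unfolding pgf_def q_def using prod_mset_unit[OF s] by (simp add: expectation_bind_pmf)
    also have "\<dots> = measure_pmf.expectation hp s * (1 / (1 + m - m * \<gamma>))"
      by (simp add: pgf_replicate_pmf[OF s] EN flip: \<gamma>_def)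
    also have "measure_pmf.expectation hp s = (\<Sum>i. h i * s i)"
      using expectation_nat_pmf_sums[of s hp, OF s'] by (simp add: hp sums_iff)
    finally show ?thesis by (simp add: \<gamma>)
  qed
  moreover have "(\<Sum>i. h i) = 1" using h by (simp add: prob_vec_def sums_iff)
  ultimately have "LF q h g m"
    using h g m by (auto simp: LF_def pgf_def unit_vec_def sub_prob_vec_def prob_vec_def sums_iff)
  then show ?thesis ..
qed

section \<open>Matrices acting on bounded vectors\<close>

definition nsum :: "rvec \<Rightarrow> bool" where
  "nsum x \<longleftrightarrow> (\<forall>i. 0 \<le> x i) \<and> summable x"

definition bvec :: "rvec \<Rightarrow> bool" where
  "bvec w \<longleftrightarrow> (\<forall>j. 0 \<le> w j) \<and> (\<exists>C. \<forall>j. w j \<le> C)"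

definition dot :: "rvec \<Rightarrow> rvec \<Rightarrow> real" where
  "dot x w = (\<Sum>j. x j * w j)"

text \<open>Matrix powers are studied through their action on bounded non-negative columns.
  Iterating a function makes the associativity of infinite matrix products a triviality, and entries
  are recovered by acting on \<open>unit_col j\<close>.\<close>

definition app :: "rmat \<Rightarrow> rvec \<Rightarrow> rvec" where
  "app A w = (\<lambda>i. dot (A i) w)"

definition bmat :: "rmat \<Rightarrow> bool" where
  "bmat A \<longleftrightarrow> (\<forall>i. nsum (A i)) \<and> (\<exists>C. \<forall>i. suminf (A i) \<le> C)"

abbreviation ones :: rvec where "ones \<equiv> \<lambda>_. 1"

abbreviation app_power :: "rmat \<Rightarrow> nat \<Rightarrow> rvec \<Rightarrow> rvec" where
  "app_power A n w \<equiv> (app A ^^ n) w"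

abbreviation unit_col :: "nat \<Rightarrow> rvec" where "unit_col j \<equiv> \<lambda>l. id_mat l j"

lemma nsumD: "nsum x \<Longrightarrow> 0 \<le> x i" "nsum x \<Longrightarrow> summable x"
  by (auto simp: nsum_def)

lemma bvecD: "bvec w \<Longrightarrow> 0 \<le> w i"
  by (auto simp: bvec_def)

lemma bmatD: "bmat A \<Longrightarrow> nsum (A i)"
  by (auto simp: bmat_def)

lemma bvec_ones: "bvec ones" by (auto simp: bvec_def)

lemma bvec_unit_col: "bvec (unit_col j)"
  by (auto simp: bvec_def id_mat_def intro!: exI[of _ 1])

lemma unit_vec_imp_bvec: "unit_vec w \<Longrightarrow> bvec w"
  by (auto simp: bvec_def unit_vec_def)

lemma bvec_add: "bvec v \<Longrightarrow> bvec w \<Longrightarrow> bvec (\<lambda>i. v i + w i)"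
  unfolding bvec_def by (metis add_mono add_nonneg_nonneg)

lemma bvec_scale: "bvec w \<Longrightarrow> 0 \<le> c \<Longrightarrow> bvec (\<lambda>i. c * w i)"
  unfolding bvec_def by (metis mult_left_mono mult_nonneg_nonneg)

lemma dot_summable: assumes "nsum x" "bvec w" shows "summable (\<lambda>j. x j * w j)"
proof -
  obtain C where C: "\<And>j. w j \<le> C" using assms by (auto simp: bvec_def)
  show ?thesis
  proof (rule summable_comparison_test'[where N = 0])
    show "summable (\<lambda>j. x j * C)" using assms by (intro summable_mult2 nsumD)
    show "norm (x n * w n) \<le> x n * C" for n
      using assms C[of n] by (auto simp: nsum_def bvec_def intro: mult_left_mono)
  qed
qed

lemma dot_sums: "nsum x \<Longrightarrow> bvec w \<Longrightarrow> (\<lambda>j. x j * w j) sums dot x w"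
  unfolding dot_def by (intro summable_sums dot_summable)

lemma dot_nonneg: "nsum x \<Longrightarrow> bvec w \<Longrightarrow> 0 \<le> dot x w"
  unfolding dot_def by (intro suminf_nonneg dot_summable) (auto simp: nsum_def bvec_def)

lemma dot_add: "nsum x \<Longrightarrow> bvec v \<Longrightarrow> bvec w \<Longrightarrow> dot x (\<lambda>i. v i + w i) = dot x v + dot x w"
  unfolding dot_def by (simp add: distrib_left suminf_add dot_summable)

lemma dot_scale: "nsum x \<Longrightarrow> bvec w \<Longrightarrow> dot x (\<lambda>i. c * w i) = c * dot x w"
  unfolding dot_def mult.left_commute[of _ c] by (rule suminf_mult[OF dot_summable])

lemma dot_mono: "nsum x \<Longrightarrow> bvec v \<Longrightarrow> bvec w \<Longrightarrow> (\<And>i. v i \<le> w i) \<Longrightarrow> dot x v \<le> dot x w"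
  unfolding dot_def by (intro suminf_le dot_summable mult_left_mono) (auto simp: nsum_def)

lemma dot_ones: "dot x ones = suminf x" by (simp add: dot_def)

lemma dot_le: assumes "nsum x" "bvec w" "\<And>j. w j \<le> C" shows "dot x w \<le> C * suminf x"
proof -
  have "dot x w \<le> (\<Sum>j. x j * C)"
    unfolding dot_def using assms by (intro suminf_le dot_summable mult_left_mono summable_mult2 nsumD)
  also have "\<dots> = suminf x * C" by (rule suminf_mult2[symmetric, OF nsumD(2)[OF assms(1)]])
  finally show ?thesis by (simp add: mult.commute)
qed

lemma dot_ge_term: "nsum x \<Longrightarrow> bvec w \<Longrightarrow> x j * w j \<le> dot x w"
  unfolding dot_def using sum_le_suminf[OF dot_summable[of x w], of "{j}"]
  by (auto simp: nsum_def bvec_def)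

lemma dot_unit_col: "dot x (unit_col j) = x j"
proof -
  have "dot x (unit_col j) = (\<Sum>l\<in>{j}. x l * unit_col j l)"
    unfolding dot_def by (intro suminf_finite) (auto simp: id_mat_def)
  then show ?thesis by (simp add: id_mat_def)
qed

lemma dot_sum:
  assumes "nsum x" "finite K" "\<And>k. k \<in> K \<Longrightarrow> bvec (w k)" "\<And>k. k \<in> K \<Longrightarrow> 0 \<le> c k"
  shows "dot x (\<lambda>i. \<Sum>k\<in>K. c k * w k i) = (\<Sum>k\<in>K. c k * dot x (w k)) \<and> bvec (\<lambda>i. \<Sum>k\<in>K. c k * w k i)"
  using assms(2,3,4)
proof (induction K rule: finite_induct)
  case empty
  then show ?case by (auto simp: dot_def bvec_def)
next
  case (insert k K)
  then show ?case
    by (auto simp: dot_add[OF assms(1)] bvec_scale dot_scale[OF assms(1)] intro!: bvec_add)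
qed

lemma app_bvec: assumes "bmat A" "bvec w" shows "bvec (app A w)"
proof -
  obtain C where C: "\<And>j. w j \<le> C" using assms by (auto simp: bvec_def)
  obtain D where D: "\<And>i. suminf (A i) \<le> D" using assms by (auto simp: bmat_def)
  have "0 \<le> C" using C[of 0] bvecD[OF assms(2), of 0] by linarith
  then have "app A w i \<le> C * D" for i
    unfolding app_def using dot_le[OF bmatD[OF assms(1)] assms(2) C, of i] D[of i]
    by (meson mult_left_mono order_trans)
  moreover have "0 \<le> app A w i" for i
    unfolding app_def by (intro dot_nonneg bmatD assms)
  ultimately show ?thesis by (auto simp: bvec_def)
qed

lemma app_power_bvec: "bmat A \<Longrightarrow> bvec w \<Longrightarrow> bvec (app_power A n w)"
  by (induction n) (auto intro: app_bvec)

lemma app_add: "bmat A \<Longrightarrow> bvec v \<Longrightarrow> bvec w \<Longrightarrow> app A (\<lambda>i. v i + w i) = (\<lambda>i. app A v i + app A w i)"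
  unfolding app_def by (simp add: dot_add bmatD)

lemma app_scale: "bmat A \<Longrightarrow> bvec w \<Longrightarrow> app A (\<lambda>i. c * w i) = (\<lambda>i. c * app A w i)"
  unfolding app_def by (simp add: dot_scale bmatD)

lemma app_power_add:
  "bmat A \<Longrightarrow> bvec v \<Longrightarrow> bvec w \<Longrightarrow>
    app_power A n (\<lambda>i. v i + w i) = (\<lambda>i. app_power A n v i + app_power A n w i)"
  by (induction n) (auto simp: app_add app_power_bvec)

lemma app_power_scale:
  "bmat A \<Longrightarrow> bvec w \<Longrightarrow> app_power A n (\<lambda>i. c * w i) = (\<lambda>i. c * app_power A n w i)"
  by (induction n) (auto simp: app_scale app_power_bvec)

lemma app_power_mono:
  assumes "bmat A" "bvec v" "bvec w" "\<And>i. v i \<le> w i"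
  shows "app_power A n v i \<le> app_power A n w i"
proof (induction n arbitrary: i)
  case (Suc n)
  then show ?case using assms by (auto simp: app_def intro!: dot_mono bmatD app_power_bvec[unfolded app_def])
qed (use assms in simp)

lemma mat_power_eq_app: "mat_power A n i j = app_power A n (unit_col j) i"
  by (induction n arbitrary: i) (auto simp: mat_mult_def app_def dot_def)

lemma mat_power_sums:
  assumes A: "bmat A" and w: "bvec w"
  shows "(\<lambda>j. mat_power A n i j * w j) sums app_power A n w i"
proof (induction n arbitrary: i)
  case 0
  have "(\<lambda>j. id_mat i j * w j) = (\<lambda>j. if j = i then w j else 0)" by (auto simp: id_mat_def)
  then show ?case using sums_single[of i w] by simp
next
  case (Suc n)
  have col: "bvec (\<lambda>l. mat_power A n l j)" for j
    unfolding mat_power_eq_app by (intro app_power_bvec A bvec_unit_col)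
  let ?a = "\<lambda>l j. A i l * (mat_power A n l j * w j)"
  have row: "?a l sums (A i l * app_power A n w l)" for l
    by (intro sums_mult Suc)
  have "(\<lambda>j. \<Sum>l. ?a l j) sums (\<Sum>l. \<Sum>j. ?a l j)"
  proof (rule tonelli_series(2))
    show "0 \<le> ?a l j" for l j
      using nsumD(1)[OF bmatD[OF A, of i]] bvecD[OF col] bvecD[OF w] by simp
    show "summable (?a l)" for l using row sums_summable by blast
    have "(\<lambda>l. \<Sum>j. ?a l j) = (\<lambda>l. A i l * app_power A n w l)" using row sums_unique by metis
    then show "summable (\<lambda>l. \<Sum>j. ?a l j)"
      using dot_summable[OF bmatD[OF A] app_power_bvec[OF A w]] by simp
  qed
  moreover have "(\<Sum>l. ?a l j) = mat_power A (Suc n) i j * w j" for j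
    using suminf_mult2[OF dot_summable[OF bmatD[OF A, of i] col[of j]], where c = "w j"]
    by (simp add: mat_mult_def ac_simps)
  moreover have "(\<Sum>l. \<Sum>j. ?a l j) = app_power A (Suc n) w i"
    using row by (simp add: app_def dot_def sums_iff)
  ultimately show ?case by simp
qed

lemma row_sums_mat_power: "bmat A \<Longrightarrow> row_sums (mat_power A n) i = app_power A n ones i"
  unfolding row_sums_def using mat_power_sums[OF _ bvec_ones, of A n i] by (simp add: sums_iff)

lemma vec_mat_power: "vec_mat g (mat_power A n) j = dot g (app_power A n (unit_col j))"
  by (simp add: vec_mat_def mat_power_eq_app dot_def)

lemma vec_mat_power_sums:
  assumes g: "nsum g" and A: "bmat A" and w: "bvec w"
  shows "(\<lambda>j. vec_mat g (mat_power A n) j * w j) sums dot g (app_power A n w)"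
proof -
  let ?a = "\<lambda>i j. g i * (mat_power A n i j * w j)"
  have col: "bvec (\<lambda>l. mat_power A n l j)" for j
    unfolding mat_power_eq_app by (intro app_power_bvec A bvec_unit_col)
  have row: "?a i sums (g i * app_power A n w i)" for i
    by (intro sums_mult mat_power_sums A w)
  have eq: "(\<Sum>j. ?a i j) = g i * app_power A n w i" for i using row sums_unique by metis
  have "(\<lambda>j. \<Sum>i. ?a i j) sums (\<Sum>i. \<Sum>j. ?a i j)"
  proof (rule tonelli_series(2))
    show "0 \<le> ?a i j" for i j
      using nsumD(1)[OF g] bvecD[OF col] bvecD[OF w] by simp
    show "summable (?a i)" for i using row sums_summable by blast
    show "summable (\<lambda>i. \<Sum>j. ?a i j)"
      unfolding eq by (intro dot_summable g app_power_bvec A w)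
  qed
  moreover have "(\<Sum>i. ?a i j) = vec_mat g (mat_power A n) j * w j" for j
    using suminf_mult2[OF dot_summable[OF g col[of j]], where c = "w j"]
    by (simp add: vec_mat_def ac_simps)
  ultimately show ?thesis by (simp add: eq dot_def)
qed

text \<open>Both \<open>v\<close> and \<open>g (I - M)\<^sup>-\<^sup>1\<close> are of this form, up to a factor: \<open>v\<close> with \<open>A = H\<close>, \<open>c = R\<close> and
  \<open>g (I - M)\<^sup>-\<^sup>1\<close> with \<open>A = M\<close>, \<open>c = 1\<close>.\<close>

lemma power_series_vec_sums:
  assumes g: "nsum g" and A: "bmat A" and w: "bvec w" and c: "0 \<le> c"
    and s: "summable (\<lambda>k. c ^ k * dot g (app_power A k w))"
  shows "(\<lambda>j. (\<Sum>k. c ^ k * (vec_mat g (mat_power A k) j * w j))) sums (\<Sum>k. c ^ k * dot g (app_power A k w))"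
proof -
  let ?a = "\<lambda>k j. c ^ k * (vec_mat g (mat_power A k) j * w j)"
  have row: "?a k sums (c ^ k * dot g (app_power A k w))" for k
    by (intro sums_mult vec_mat_power_sums g A w)
  have eq: "(\<Sum>j. ?a k j) = c ^ k * dot g (app_power A k w)" for k using row sums_unique by metis
  have "(\<lambda>j. \<Sum>k. ?a k j) sums (\<Sum>k. \<Sum>j. ?a k j)"
  proof (rule tonelli_series(2))
    show "0 \<le> ?a k j" for k j unfolding vec_mat_power
      by (intro mult_nonneg_nonneg zero_le_power c dot_nonneg g app_power_bvec A bvec_unit_col bvecD[OF w])
    show "summable (?a k)" for k using row sums_summable by blast
    show "summable (\<lambda>k. \<Sum>j. ?a k j)" unfolding eq by (rule s)
  qed
  then show ?thesis by (simp only: eq)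
qed

section \<open>The renewal equation of the mean matrix\<close>

lemma dot_affine_sum:
  assumes x: "nsum x" and u: "bvec u" and m: "0 \<le> m" and K: "finite K"
    and w: "\<And>k. k \<in> K \<Longrightarrow> bvec (w k)" "\<And>k. k \<in> K \<Longrightarrow> 0 \<le> c k"
  shows "dot x (\<lambda>i. u i + m * (\<Sum>k\<in>K. c k * w k i)) = dot x u + m * (\<Sum>k\<in>K. c k * dot x (w k))"
proof -
  have s: "dot x (\<lambda>i. \<Sum>k\<in>K. c k * w k i) = (\<Sum>k\<in>K. c k * dot x (w k))"
    and b: "bvec (\<lambda>i. \<Sum>k\<in>K. c k * w k i)"
    using dot_sum[OF x K w] by auto
  show ?thesis by (simp add: dot_add[OF x u bvec_scale[OF b m]] dot_scale[OF x b] s)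
qed

locale lf_params =
  fixes H :: rmat and g :: rvec and m :: real
  assumes H: "sub_stochastic H" and g: "prob_vec g" and m: "0 < m"
begin

text \<open>Taken as a formula here; that the process has this mean matrix is derived later from the
  offspring generating functions.\<close>

definition M :: rmat where "M = (\<lambda>i j. H i j + m * row_sums H i * g j)"

definition d :: "nat \<Rightarrow> real" where "d n = dot g (app_power H n ones)"

definition x :: "nat \<Rightarrow> rvec \<Rightarrow> real" where "x n w = dot g (app_power M n w)"

lemma ng: "nsum g" and sum_g: "suminf g = 1"
  using g by (auto simp: prob_vec_def nsum_def sums_iff)

lemma bH: "bmat H"
  using H by (auto simp: bmat_def sub_stochastic_def sub_prob_vec_def nsum_def)

lemma row_sums_H: "row_sums H i = app H ones i"
  by (simp add: row_sums_def app_def dot_def)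

lemma app_H_ones: "0 \<le> app H ones i" "app H ones i \<le> 1"
  using bvecD[OF app_bvec[OF bH bvec_ones]] H
  by (auto simp: app_def dot_ones sub_stochastic_def sub_prob_vec_def)

lemma M_sums: "M i sums (app H ones i + m * app H ones i)"
proof -
  have "H i sums app H ones i"
    using dot_sums[OF bmatD[OF bH] bvec_ones, of i] by (simp add: app_def)
  moreover have "(\<lambda>j. m * row_sums H i * g j) sums (m * row_sums H i * 1)"
    using g by (intro sums_mult) (auto simp: prob_vec_def)
  ultimately show ?thesis unfolding M_def row_sums_H using sums_add by fastforce
qed

lemma bM: "bmat M"
  unfolding bmat_def nsum_def
proof (intro conjI allI exI)
  fix i
  show "summable (M i)" using M_sums sums_summable by blast
  have "suminf (M i) = app H ones i + m * app H ones i" using M_sums sums_unique by metis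
  also have "\<dots> \<le> 1 + m * 1" using m app_H_ones[of i] by (intro add_mono mult_left_mono) auto
  finally show "suminf (M i) \<le> 1 + m * 1" .
  show "0 \<le> M i j" for j
    using m app_H_ones[of i] nsumD(1)[OF ng] nsumD(1)[OF bmatD[OF bH]] by (simp add: M_def row_sums_H)
qed

lemma app_M: assumes w: "bvec w" shows "app M w i = app H w i + m * (app H ones i * dot g w)"
proof -
  have "(\<lambda>j. H i j * w j + m * app H ones i * (g j * w j)) sums (app H w i + m * app H ones i * dot g w)"
    unfolding app_def[of H w] by (intro sums_add sums_mult dot_sums bmatD bH w ng)
  moreover have "H i j * w j + m * app H ones i * (g j * w j) = M i j * w j" for j
    by (simp add: M_def row_sums_H algebra_simps)
  ultimately show ?thesis by (simp add: app_def[of M] dot_def[of "M i"] sums_iff)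
qed

lemma d_seq_eq: "d_seq H g n = d n"
  by (simp add: d_seq_def d_def dot_def row_sums_mat_power[OF bH])

lemma d_0: "d 0 = 1" by (simp add: d_def dot_ones sum_g)

lemma d_nonneg: "0 \<le> d n"
  unfolding d_def by (intro dot_nonneg ng app_power_bvec bH bvec_ones)

lemma x_nonneg: "bvec w \<Longrightarrow> 0 \<le> x n w"
  unfolding x_def by (intro dot_nonneg ng app_power_bvec bM)

text \<open>M is H plus the rank-one matrix m (H 1) g. The terms of M^n are sorted by the first use
  of the rank-one part: k factors H, then the rank-one factor, which restarts from g with n - k - 1
  factors M left.\<close>

lemma app_power_M_expand:
  assumes w: "bvec w"
  shows "app_power M n w i = app_power H n w i + m * (\<Sum>k<n. x (n - Suc k) w * app_power H (Suc k) ones i)"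
proof (induction n arbitrary: i)
  case (Suc n)
  let ?c = "\<lambda>k. x (n - Suc k) w"
  have "app H (app_power M n w) i = dot (H i) (\<lambda>i. app_power H n w i + m * (\<Sum>k<n. ?c k * app_power H (Suc k) ones i))"
    unfolding app_def[of H "app_power M n w"] using Suc by presburger
  also have "\<dots> = app_power H (Suc n) w i + m * (\<Sum>k<n. ?c k * app_power H (Suc (Suc k)) ones i)"
    using dot_affine_sum[where x = "H i" and u = "app_power H n w" and m = m and K = "{..<n}" and c = ?c
        and w = "\<lambda>k. app_power H (Suc k) ones", OF bmatD[OF bH] app_power_bvec[OF bH w] less_imp_le[OF m]
        finite_lessThan app_power_bvec[OF bH bvec_ones] x_nonneg[OF w]]
    by (simp add: app_def)
  finally have 1: "app H (app_power M n w) i = app_power H (Suc n) w i + m * (\<Sum>k<n. ?c k * app_power H (Suc (Suc k)) ones i)" .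
  have "app_power M (Suc n) w i = app H (app_power M n w) i + m * (app H ones i * x n w)"
    by (simp add: app_M[OF app_power_bvec[OF bM w]] x_def)
  also have "\<dots> = app_power H (Suc n) w i + m * (\<Sum>k<Suc n. x (Suc n - Suc k) w * app_power H (Suc k) ones i)"
    unfolding 1 sum.lessThan_Suc_shift by (simp add: algebra_simps)
  finally show ?case .
qed simp

lemma x_renewal:
  assumes w: "bvec w"
  shows "x n w = dot g (app_power H n w) + m * (\<Sum>k<n. x (n - Suc k) w * d (Suc k))"
proof -
  have "app_power M n w = (\<lambda>i. app_power H n w i + m * (\<Sum>k<n. x (n - Suc k) w * app_power H (Suc k) ones i))"
    using app_power_M_expand[OF w] by blast
  then show ?thesis unfolding x_def[of n] d_def using m
    by (simp only:) (intro dot_affine_sum ng app_power_bvec bH w bvec_ones x_nonneg, auto)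
qed

end

locale lf_irreducible = lf_params +
  assumes irr: "irreducible_mat M" and aper: "aperiodic_mat M"
begin

text \<open>A vanishing row of H makes the same row of M vanish, and then no type can be reached
  from \<open>i\<close>.\<close>

lemma app_H_ones_pos: "0 < app H ones i"
proof (rule ccontr)
  assume "\<not> 0 < app H ones i"
  then have z: "app H ones i = 0" using app_H_ones(1)[of i] by linarith
  have "app H w i \<le> 0" if w: "bvec w" for w
  proof -
    obtain C where "\<And>j. w j \<le> C" using w by (auto simp: bvec_def)
    from dot_le[OF bmatD[OF bH] w this, of i] show ?thesis using z by (simp add: app_def dot_ones)
  qed
  then have "app M w i \<le> 0" if "bvec w" for w using that z by (simp add: app_M)
  moreover obtain n where "1 \<le> n" "0 < mat_power M n i 0"
    using irr unfolding irreducible_mat_def by blast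
  moreover obtain k where "n = Suc k" using \<open>1 \<le> n\<close> by (cases n) auto
  ultimately show False
    unfolding mat_power_eq_app using app_power_bvec[OF bM bvec_unit_col, of k 0] by fastforce
qed

lemma g_pos: "\<exists>j. 0 < g j"
proof (rule ccontr)
  assume "\<not> ?thesis"
  then have "g = (\<lambda>_. 0)" using nsumD(1)[OF ng] by (auto simp: fun_eq_iff not_less intro: antisym)
  then show False using sum_g by simp
qed

lemma dot_g_pos:
  assumes "bvec w" "\<And>i. 0 < w i" shows "0 < dot g w"
proof -
  obtain j where "0 < g j" using g_pos by blast
  then have "0 < g j * w j" using assms by simp
  then show ?thesis using dot_ge_term[OF ng assms(1), of j] by linarith
qed

lemma app_power_M_ones_pos: "0 < app_power M n ones i"
proof (induction n arbitrary: i)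
  case (Suc n)
  have b: "bvec (app_power M n ones)" by (intro app_power_bvec bM bvec_ones)
  have "0 < m * (app H ones i * dot g (app_power M n ones))"
    using m app_H_ones_pos dot_g_pos[OF b Suc] by simp
  moreover have "0 \<le> app H (app_power M n ones) i" by (rule bvecD[OF app_bvec[OF bH b]])
  ultimately show ?case by (simp add: app_M[OF b])
qed simp

lemma x_unit_col_pos: "\<exists>n. 0 < x n (unit_col i)"
proof -
  obtain j where j: "0 < g j" using g_pos by blast
  obtain n where "0 < mat_power M n j i" using irr unfolding irreducible_mat_def by blast
  then have "0 < g j * app_power M n (unit_col i) j" using j by (simp add: mat_power_eq_app)
  then have "0 < x n (unit_col i)" unfolding x_def
    using dot_ge_term[OF ng app_power_bvec[OF bM bvec_unit_col], of j n i] by linarith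
  then show ?thesis ..
qed

text \<open>Otherwise the source of the renewal equation for e_i is zero, so g M^n e_i = 0 for all
  n, which contradicts irreducibility.\<close>

lemma H_reaches: "\<exists>n. 0 < dot g (app_power H n (unit_col i))"
proof (rule ccontr)
  assume "\<not> ?thesis"
  then have z: "dot g (app_power H n (unit_col i)) = 0" for n
    using dot_nonneg[OF ng app_power_bvec[OF bH bvec_unit_col], of n i] by (metis less_eq_real_def)
  have "x n (unit_col i) = 0" for n
  proof (induction n rule: less_induct)
    case (less n)
    show ?case by (subst x_renewal[OF bvec_unit_col]) (simp add: z less)
  qed
  then show False using x_unit_col_pos[of i] by simp
qed

text \<open>Of all paths of length l + k started from g, only those at \<open>i\<close> at time l
  are kept. This is how information on the averaged sequence \<open>d\<close> passes to single
  types.\<close>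

lemma d_add_ge: "dot g (app_power H l (unit_col i)) * app_power H k ones i \<le> d (l + k)"
proof -
  let ?c = "app_power H k ones i"
  have b: "bvec (app_power H k ones)" by (intro app_power_bvec bH bvec_ones)
  have "dot g (app_power H l (\<lambda>j. ?c * unit_col i j)) \<le> dot g (app_power H l (app_power H k ones))"
    using bvecD[OF b]
    by (intro dot_mono ng app_power_bvec bH b bvec_scale bvec_unit_col app_power_mono)
       (auto simp: id_mat_def)
  also have "\<dots> = d (l + k)" by (simp add: d_def funpow_add)
  finally show ?thesis
    unfolding app_power_scale[OF bH bvec_unit_col] dot_scale[OF ng app_power_bvec[OF bH bvec_unit_col]]
    by (simp add: mult.commute)
qed

text \<open>Fix l with g H^l e_i > 0. By \<open>d_add_ge\<close> the i-th row sum of H^k is at most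
  a constant times d (k + l).\<close>

lemma summable_app_power_H:
  assumes R: "0 < R" and s: "summable (\<lambda>n. d n * R ^ n)"
  shows "summable (\<lambda>k. R ^ k * app_power H k ones i)"
proof -
  obtain l where l: "0 < dot g (app_power H l (unit_col i))" (is "0 < ?a") using H_reaches by blast
  have "summable (\<lambda>k. d (k + l) * R ^ (k + l))" using s by (subst summable_iff_shift)
  then have "summable (\<lambda>k. (d (k + l) * R ^ (k + l)) * (1 / (?a * R ^ l)))" by (rule summable_mult2)
  then show ?thesis
  proof (rule summable_comparison_test'[where N = 0])
    fix k
    have "app_power H k ones i \<le> d (k + l) / ?a"
      using d_add_ge[of l i k] l by (simp add: field_simps add.commute)
    then have "R ^ k * app_power H k ones i \<le> R ^ k * (d (k + l) / ?a)" using R by (intro mult_left_mono) auto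
    also have "\<dots> = (d (k + l) * R ^ (k + l)) * (1 / (?a * R ^ l))"
      using R l by (simp add: power_add field_simps)
    finally show "norm (R ^ k * app_power H k ones i) \<le> (d (k + l) * R ^ (k + l)) * (1 / (?a * R ^ l))"
      using R bvecD[OF app_power_bvec[OF bH bvec_ones], of k i] by simp
  qed
qed

text \<open>If \<open>q\<close> divides every \<open>n\<close> with \<open>d n > 0\<close>, then \<open>q\<close> divides the length of every path from the
  support of \<open>g\<close> to a fixed type, hence also the length of every loop of \<open>M\<close> at that type.\<close>

lemma gcd_support: "Gcd {n. 1 \<le> n \<and> 0 < d n} = 1"
proof -
  define q where "q = Gcd {n. 1 \<le> n \<and> 0 < d n}"
  have qd: "q dvd n" if "0 < d n" for n
    using that unfolding q_def by (cases "n = 0") (auto intro: Gcd_dvd)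
  have A: "q dvd l + k" if "0 < dot g (app_power H l (unit_col i))" "0 < app_power H k ones i" for l k i
    using d_add_ge[of l i k] mult_pos_pos[OF that] by (intro qd) linarith
  have B: "q dvd l" if "0 < dot g (app_power H l (unit_col i))" for l i
    using A[OF that, of 0] by simp
  have C: "q dvd n" if "0 < x n (unit_col i)" for n i
    using that
  proof (induction n rule: less_induct)
    case (less n)
    show ?case
    proof (cases "0 < dot g (app_power H n (unit_col i))")
      case False
      then have "0 < m * (\<Sum>k<n. x (n - Suc k) (unit_col i) * d (Suc k))"
        using less.prems x_renewal[OF bvec_unit_col, of n i] by linarith
      then have "0 < (\<Sum>k<n. x (n - Suc k) (unit_col i) * d (Suc k))" using m by (simp add: zero_less_mult_iff)
      then obtain k where k: "k < n" "0 < x (n - Suc k) (unit_col i) * d (Suc k)"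
        by (metis (no_types, lifting) lessThan_iff not_less sum_nonpos)
      then have "0 < x (n - Suc k) (unit_col i)" "0 < d (Suc k)"
        using x_nonneg[OF bvec_unit_col, of "n - Suc k" i] d_nonneg[of "Suc k"] by (auto simp: zero_less_mult_iff)
      then have "q dvd (n - Suc k)" "q dvd Suc k" using less.IH[of "n - Suc k"] k qd by auto
      then have "q dvd (n - Suc k) + Suc k" by (rule dvd_add)
      then show ?thesis using k(1) by simp
    qed (rule B)
  qed
  have "q dvd n" if n: "1 \<le> n" "0 < mat_power M n 0 0" for n
  proof -
    let ?e = "unit_col 0"
    obtain l where l: "0 < dot g (app_power H l ?e)" using H_reaches by blast
    have D: "q dvd k" if "0 < app_power H k ones 0" for k
      using A[OF l that] B[OF l] by (simp add: dvd_add_right_iff)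
    \<comment> \<open>A loop of M at type 0 either uses H alone, or splits at its first rank-one
      factor into \<open>Suc k\<close> steps out of type 0 and a return from g in
      \<open>n - Suc k\<close> steps. D deals with the former and with the first piece, C with the
      return.\<close>
    have "0 < app_power H n ?e 0 + m * (\<Sum>k<n. x (n - Suc k) ?e * app_power H (Suc k) ones 0)"
      using n(2) unfolding mat_power_eq_app app_power_M_expand[OF bvec_unit_col] .
    then consider "0 < app_power H n ?e 0" | "0 < (\<Sum>k<n. x (n - Suc k) ?e * app_power H (Suc k) ones 0)"
      using m by (smt (verit) mult_nonneg_nonpos)
    then show ?thesis
    proof cases
      case 1
      also have "app_power H n ?e 0 \<le> app_power H n ones 0"
        by (intro app_power_mono bH bvec_unit_col bvec_ones) (auto simp: id_mat_def)
      finally show ?thesis by (rule D)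
    next
      case 2
      then obtain k where k: "k < n" "0 < x (n - Suc k) ?e * app_power H (Suc k) ones 0"
        by (metis (no_types, lifting) lessThan_iff not_less sum_nonpos)
      then have "0 < x (n - Suc k) ?e" "0 < app_power H (Suc k) ones 0"
        using x_nonneg[OF bvec_unit_col, of "n - Suc k" 0] bvecD[OF app_power_bvec[OF bH bvec_ones], of "Suc k" 0]
        by (auto simp: zero_less_mult_iff simp del: funpow.simps)
      then have "q dvd (n - Suc k) + Suc k" using C D by (intro dvd_add) auto
      then show ?thesis using k(1) by simp
    qed
  qed
  then have "q dvd Gcd {n. 1 \<le> n \<and> 0 < mat_power M n 0 0}" by (intro Gcd_greatest) auto
  then show ?thesis using aper unfolding aperiodic_mat_def q_def by simp
qed

end

section \<open>Limits of matrix powers\<close>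

lemma app_power_le_ones:
  assumes A: "bmat A" and w: "bvec w" and C: "\<And>j. w j \<le> C"
  shows "app_power A n w i \<le> C * app_power A n ones i"
proof -
  have C0: "0 \<le> C" using C[of 0] bvecD[OF w, of 0] by linarith
  have "app_power A n w i \<le> app_power A n (\<lambda>i. C * ones i) i"
    using C by (intro app_power_mono A w bvec_scale bvec_ones C0) auto
  also have "\<dots> = C * app_power A n ones i"
    unfolding app_power_scale[OF A bvec_ones] ..
  finally show ?thesis .
qed

text \<open>The number e^{-\<alpha>} is used only through m f(R) = 1 and the finiteness of \<beta>;
  \<open>R_of_beta_finite\<close> extracts both from the definitions.\<close>

locale lf_recurrent = lf_irreducible +
  fixes R :: real
  assumes R: "0 < R" and crit: "(\<lambda>n. d (Suc n) * R ^ Suc n) sums (1 / m)"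
    and finite_mean: "summable (\<lambda>n. real (Suc n) * d (Suc n) * R ^ Suc n)"
begin

text \<open>The renewal equation has no term k = 0, whereas \<open>d 0 = 1\<close>; hence the
  separate value at 0.\<close>

definition p :: "nat \<Rightarrow> real" where "p n = (if n = 0 then 0 else m * (d n * R ^ n))"

definition \<beta> :: real where "\<beta> = m * (\<Sum>n. real (Suc n) * d (Suc n) * R ^ Suc n)"

lemma mean_sums: "(\<lambda>n. real n * p n) sums \<beta>"
proof -
  have "(\<lambda>n. real (Suc n) * p (Suc n)) sums \<beta>"
    using sums_mult[OF summable_sums[OF finite_mean], of m] by (simp add: p_def \<beta>_def ac_simps)
  from sums_Suc[OF this] show ?thesis by (simp add: p_def)
qed

sublocale renewal p
proof
  have "(\<lambda>n. p (Suc n)) sums 1"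
    using sums_mult[OF crit, of m] m by (simp add: p_def)
  from sums_Suc[OF this] show "p sums 1" by (simp add: p_def[of 0])
  have "{n. 0 < p n} = {n. 1 \<le> n \<and> 0 < d n}"
    using m R by (auto simp: p_def zero_less_mult_iff)
  then show "Gcd {n. 0 < p n} = 1" using gcd_support by simp
  show "summable (\<lambda>n. real n * p n)" using mean_sums by (rule sums_summable)
  show "0 \<le> p n" for n using m R d_nonneg[of n] by (simp add: p_def)
qed (simp add: p_def)

lemma mean_eq: "(\<Sum>n. real n * p n) = \<beta>"
  using mean_sums by (rule sums_unique[symmetric])

lemma \<beta>_pos: "0 < \<beta>"
  using mean_pos by (simp add: mean_eq)

text \<open>\<open>V w\<close> is (1 + m)/m times v w, and \<open>S i\<close> below is \<beta>/(1 +
  m) times u_i, so the limit \<open>m * S i * (V w / \<beta>)\<close> is u_i (v w).\<close>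

definition V :: "rvec \<Rightarrow> real" where "V w = (\<Sum>n. R ^ n * dot g (app_power H n w))"

definition S :: rvec where "S i = (\<Sum>k. R ^ Suc k * app_power H (Suc k) ones i)"

lemma d_sums: "(\<lambda>n. d n * R ^ n) sums (1 + 1 / m)"
  using sums_Suc[OF crit] by (simp add: d_0 add.commute)

lemma summable_V: assumes w: "bvec w" shows "summable (\<lambda>n. R ^ n * dot g (app_power H n w))"
proof -
  obtain C where C: "\<And>j. w j \<le> C" using w by (auto simp: bvec_def)
  have C0: "0 \<le> C" using C[of 0] bvecD[OF w, of 0] by linarith
  have "dot g (app_power H n w) \<le> C * d n" for n
  proof -
    have "dot g (app_power H n w) \<le> dot g (\<lambda>i. C * app_power H n ones i)"
      by (intro dot_mono ng app_power_bvec bH w bvec_scale bvec_ones C0 app_power_le_ones C)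
    also have "\<dots> = C * d n"
      unfolding d_def by (intro dot_scale ng app_power_bvec bH bvec_ones)
    finally show ?thesis .
  qed
  then have "norm (R ^ n * dot g (app_power H n w)) \<le> C * (d n * R ^ n)" for n
    using R dot_nonneg[OF ng app_power_bvec[OF bH w], of n] by (simp add: mult.commute mult_left_mono algebra_simps)
  then show ?thesis
    by (intro summable_comparison_test'[OF summable_mult[OF sums_summable[OF d_sums]]])
qed

lemma V_ones: "V ones = (1 + m) / m"
proof -
  have "V ones = (\<Sum>n. d n * R ^ n)" by (simp add: V_def d_def mult.commute)
  then show ?thesis using d_sums m by (simp add: sums_iff field_simps)
qed

lemma summable_S: "summable (\<lambda>k. R ^ Suc k * app_power H (Suc k) ones i)"
  using summable_app_power_H[OF R sums_summable[OF d_sums]] by (subst summable_Suc_iff)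

lemma S_pos: "0 < S i"
proof -
  have "(\<Sum>k\<in>{0}. R ^ Suc k * app_power H (Suc k) ones i) \<le> S i"
    unfolding S_def
    by (intro sum_le_suminf summable_S) (use R bvecD[OF app_power_bvec[OF bH bvec_ones]] in \<open>auto simp del: funpow.simps\<close>)
  moreover have "0 < R * app H ones i" using R app_H_ones_pos by simp
  ultimately show ?thesis by simp
qed

lemma x_limit:
  assumes w: "bvec w"
  shows "(\<lambda>n. R ^ n * x n w) \<longlonglongrightarrow> V w / \<beta>"
proof -
  let ?b = "\<lambda>n. R ^ n * dot g (app_power H n w)" and ?y = "\<lambda>n. R ^ n * x n w"
  have nn: "0 \<le> ?b n" for n
    using R dot_nonneg[OF ng app_power_bvec[OF bH w], of n] by simp
  have "?y n = ?b n + (\<Sum>k\<le>n. p k * ?y (n - k))" for n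
  proof -
    have "(\<Sum>k\<le>n. p k * ?y (n - k)) = (\<Sum>k<n. p (Suc k) * ?y (n - Suc k))"
      unfolding lessThan_Suc_atMost[symmetric] sum.lessThan_Suc_shift by (simp add: p_def)
    also have "\<dots> = (\<Sum>k<n. R ^ n * (m * (x (n - Suc k) w * d (Suc k))))"
    proof (intro sum.cong refl)
      fix k assume "k \<in> {..<n}"
      then have "R ^ n = R ^ Suc k * R ^ (n - Suc k)" by (simp flip: power_add power_Suc)
      then show "p (Suc k) * ?y (n - Suc k) = R ^ n * (m * (x (n - Suc k) w * d (Suc k)))"
        by (simp add: p_def)
    qed
    also have "\<dots> = R ^ n * (m * (\<Sum>k<n. x (n - Suc k) w * d (Suc k)))"
      by (simp add: sum_distrib_left)
    finally show ?thesis using x_renewal[OF w, of n] by (simp add: distrib_left)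
  qed
  moreover have "summable (\<lambda>n. \<bar>?b n\<bar>)" using summable_V[OF w] by (simp only: abs_of_nonneg[OF nn])
  ultimately have "solution ?b ?y" unfolding solution_def by blast
  from renewal_theorem[OF this] show ?thesis by (simp add: V_def mean_eq)
qed

text \<open>In the expansion of M^n w multiplied by R^n, the H-part vanishes because its series
  converges, and the rest is the convolution of the summable sequence R^k H^k 1, k \<ge> 1, with the
  convergent sequence \<open>R ^ n * x n w\<close>.\<close>

lemma app_power_M_limit:
  assumes w: "bvec w"
  shows "(\<lambda>n. R ^ n * app_power M n w i) \<longlonglongrightarrow> m * S i * (V w / \<beta>)"
proof -
  let ?z = "\<lambda>k. if k = 0 then 0 else R ^ k * app_power H k ones i"
  have z: "?z sums S i"
  proof -
    have "(\<lambda>k. ?z (Suc k)) sums S i" unfolding S_def using summable_sums[OF summable_S[of i]] by simp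
    from sums_Suc[OF this] show ?thesis by simp
  qed
  have z0: "0 \<le> ?z k" for k
    using R bvecD[OF app_power_bvec[OF bH bvec_ones]] by simp
  from convolution_tendsto[OF z0 sums_summable[OF z] x_limit[OF w]] z
  have conv: "(\<lambda>n. \<Sum>k\<le>n. ?z k * (R ^ (n - k) * x (n - k) w)) \<longlonglongrightarrow> S i * (V w / \<beta>)"
    by (simp only: sums_iff)
  have eq: "(\<Sum>k\<le>n. ?z k * (R ^ (n - k) * x (n - k) w)) = R ^ n * (\<Sum>k<n. x (n - Suc k) w * app_power H (Suc k) ones i)" for n
  proof -
    have "(\<Sum>k\<le>n. ?z k * (R ^ (n - k) * x (n - k) w)) = (\<Sum>k<n. ?z (Suc k) * (R ^ (n - Suc k) * x (n - Suc k) w))"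
      unfolding lessThan_Suc_atMost[symmetric] sum.lessThan_Suc_shift by simp
    also have "\<dots> = (\<Sum>k<n. R ^ n * (x (n - Suc k) w * app_power H (Suc k) ones i))"
    proof (intro sum.cong refl)
      fix k assume "k \<in> {..<n}"
      then have "R ^ n = R ^ Suc k * R ^ (n - Suc k)" by (simp flip: power_add power_Suc)
      then show "?z (Suc k) * (R ^ (n - Suc k) * x (n - Suc k) w) = R ^ n * (x (n - Suc k) w * app_power H (Suc k) ones i)"
        by simp
    qed
    finally show ?thesis by (simp add: sum_distrib_left)
  qed
  have h0: "(\<lambda>n. R ^ n * app_power H n w i) \<longlonglongrightarrow> 0"
  proof -
    obtain C where C: "\<And>j. w j \<le> C" using w by (auto simp: bvec_def)
    have le: "app_power H n w i \<le> C * app_power H n ones i" for n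
      by (intro app_power_le_ones bH w C)
    show ?thesis
    proof (rule tendsto_sandwich[of "\<lambda>_. 0" _ _ "\<lambda>n. C * (R ^ n * app_power H n ones i)"])
      show "\<forall>\<^sub>F n in sequentially. 0 \<le> R ^ n * app_power H n w i"
        using R bvecD[OF app_power_bvec[OF bH w]] by (intro always_eventually) simp
      show "\<forall>\<^sub>F n in sequentially. R ^ n * app_power H n w i \<le> C * (R ^ n * app_power H n ones i)"
        using mult_left_mono[OF le, of "R ^ _"] R by (intro always_eventually allI) (simp add: mult.left_commute)
      show "(\<lambda>n. C * (R ^ n * app_power H n ones i)) \<longlonglongrightarrow> 0"
        using tendsto_mult_right_zero[OF summable_LIMSEQ_zero[OF summable_app_power_H[OF R sums_summable[OF d_sums]]]] .
    qed simp
  qed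
  have "(\<lambda>n. R ^ n * app_power H n w i + m * (\<Sum>k\<le>n. ?z k * (R ^ (n - k) * x (n - k) w)))
    \<longlonglongrightarrow> 0 + m * (S i * (V w / \<beta>))"
    by (intro tendsto_add h0 tendsto_mult_left conv)
  moreover have "R ^ n * app_power M n w i = R ^ n * app_power H n w i + m * (\<Sum>k\<le>n. ?z k * (R ^ (n - k) * x (n - k) w))" for n
    unfolding eq app_power_M_expand[OF w] by (simp add: distrib_left)
  ultimately show ?thesis by (simp add: mult.assoc)
qed

end

section \<open>The subcritical case: the Neumann series of M\<close>

locale lf_subcritical = lf_recurrent + assumes R_gt_1: "1 < R"
begin

definition \<mu> :: real where "\<mu> = m * (\<Sum>n. d (Suc n))"
definition \<Lambda> :: real where "\<Lambda> = 1 + (\<Sum>n. d (Suc n))"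
text \<open>This is g (I - M)^{-1} w.\<close>

definition G :: "rvec \<Rightarrow> real" where "G w = (\<Sum>n. x n w)"

lemma summable_of_geometric:
  assumes "(\<lambda>n. R ^ n * y n) \<longlonglongrightarrow> L" shows "summable (y :: nat \<Rightarrow> real)"
proof -
  obtain C where C: "\<And>n. \<bar>R ^ n * y n\<bar> \<le> C"
    using convergent_imp_Bseq[OF convergentI[OF assms]] unfolding Bseq_def by auto
  have "norm (y n) \<le> C * (1 / R) ^ n" for n
    using C[of n] R by (simp add: abs_mult field_simps)
  moreover have "summable (\<lambda>n. C * (1 / R) ^ n)"
    using R_gt_1 by (intro summable_mult summable_geometric) simp
  ultimately show ?thesis using summable_comparison_test'[of "\<lambda>n. C * (1 / R) ^ n" 0 y] by blast
qed

lemma summable_x: "bvec w \<Longrightarrow> summable (\<lambda>n. x n w)"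
  using summable_of_geometric[OF x_limit] .

lemma summable_le_power:
  assumes "summable (\<lambda>n. R ^ n * y n)" "\<And>n. 0 \<le> y n" shows "summable y"
proof (rule summable_comparison_test'[OF assms(1), of 0])
  fix n
  have "1 * y n \<le> R ^ n * y n" using R_gt_1 assms(2) by (intro mult_right_mono one_le_power) auto
  then show "norm (y n) \<le> R ^ n * y n" using assms(2)[of n] by simp
qed

lemma summable_d: "summable d"
  using summable_le_power[of d] sums_summable[OF d_sums] d_nonneg by (simp add: mult.commute)

text \<open>Since m f(R) = 1, some d_n with n \<ge> 1 is positive, so f is strictly increasing and R
  > 1 gives m f(1) < 1.\<close>

lemma \<mu>_less_1: "\<mu> < 1"
proof -
  have lt: "(\<Sum>n. d (Suc n)) < (\<Sum>n. d (Suc n) * R ^ Suc n)"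
  proof -
    have le: "d (Suc n) \<le> d (Suc n) * R ^ Suc n" for n
      using mult_left_mono[OF one_le_power[of R "Suc n"] d_nonneg[of "Suc n"]] R_gt_1 by simp
    obtain n where n: "0 < d (Suc n)"
    proof (rule ccontr)
      assume "\<not> thesis"
      with that have "d (Suc n) = 0" for n using d_nonneg[of "Suc n"] by (metis less_eq_real_def)
      then have "(\<lambda>n. 0) sums (1 / m)" using crit by simp
      then show False using m sums_unique2[OF sums_zero, of "1 / m"] by simp
    qed
    have "0 < (\<Sum>n. d (Suc n) * R ^ Suc n - d (Suc n))"
    proof (rule suminf_pos2[where i = n])
      show "summable (\<lambda>n. d (Suc n) * R ^ Suc n - d (Suc n))"
        using crit summable_d by (intro summable_diff) (auto simp: sums_iff summable_Suc_iff)
      have "d (Suc n) * 1 < d (Suc n) * R ^ Suc n"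
        using n one_less_power[OF R_gt_1, of "Suc n"] by (intro mult_strict_left_mono) auto
      then show "0 < d (Suc n) * R ^ Suc n - d (Suc n)" by simp
    qed (use le in \<open>auto simp: algebra_simps\<close>)
    also have "\<dots> = (\<Sum>n. d (Suc n) * R ^ Suc n) - (\<Sum>n. d (Suc n))"
      using crit summable_d by (intro suminf_diff[symmetric]) (auto simp: sums_iff summable_Suc_iff)
    finally show ?thesis by simp
  qed
  have "m * (\<Sum>n. d (Suc n)) < m * (1 / m)"
    using lt crit m by (intro mult_strict_left_mono) (auto simp: sums_iff)
  then show ?thesis using m by (simp add: \<mu>_def)
qed

lemma \<Lambda>_pos: "0 < \<Lambda>"
  unfolding \<Lambda>_def using summable_d d_nonneg
  by (intro add_pos_nonneg suminf_nonneg) (auto simp: summable_Suc_iff)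

lemma summable_H: "bvec w \<Longrightarrow> summable (\<lambda>n. dot g (app_power H n w))"
  using summable_le_power[OF summable_V] dot_nonneg ng app_power_bvec bH by blast

text \<open>The renewal equation summed over all n: the Cauchy product turns its convolution into
  \<mu> times \<open>G w\<close>.\<close>

lemma G_eq:
  assumes w: "bvec w"
  shows "(1 - \<mu>) * G w = (\<Sum>n. dot g (app_power H n w))"
proof -
  let ?e = "\<lambda>n. if n = 0 then 0 else d n"
  have e: "?e sums (\<Sum>n. d (Suc n))"
    using sums_Suc[OF summable_sums[of "\<lambda>n. ?e (Suc n)"]] summable_d by (simp add: summable_Suc_iff)
  have "(\<lambda>n. \<Sum>k\<le>n. ?e k * x (n - k) w) sums ((\<Sum>n. ?e n) * (\<Sum>n. x n w))"
    using sums_summable[OF e] summable_x[OF w] d_nonneg x_nonneg[OF w]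
    by (intro Cauchy_product_sums) auto
  then have c: "(\<lambda>n. \<Sum>k\<le>n. ?e k * x (n - k) w) sums ((\<Sum>n. d (Suc n)) * G w)"
    using e by (simp add: sums_iff G_def)
  have eq: "(\<Sum>k\<le>n. ?e k * x (n - k) w) = (\<Sum>k<n. x (n - Suc k) w * d (Suc k))" for n
    unfolding lessThan_Suc_atMost[symmetric] sum.lessThan_Suc_shift by (simp add: mult.commute)
  have "(\<lambda>n. dot g (app_power H n w) + m * (\<Sum>k<n. x (n - Suc k) w * d (Suc k))) sums
      ((\<Sum>n. dot g (app_power H n w)) + m * ((\<Sum>n. d (Suc n)) * G w))"
    using c unfolding eq by (intro sums_add sums_mult summable_sums summable_H w)
  then have "G w = (\<Sum>n. dot g (app_power H n w)) + \<mu> * G w"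
    unfolding x_renewal[OF w, symmetric] by (simp add: G_def \<mu>_def sums_iff mult.assoc)
  then show ?thesis by (simp add: algebra_simps)
qed

lemma G_ones: "G ones = \<Lambda> / (1 - \<mu>)"
proof -
  have "(\<Sum>n. dot g (app_power H n ones)) = \<Lambda>"
    using suminf_split_head[OF summable_d] by (simp add: \<Lambda>_def d_0 flip: d_def)
  then show ?thesis using G_eq[OF bvec_ones] \<mu>_less_1 by (simp add: field_simps)
qed

text \<open>Because m \<Lambda> = m + \<mu>. This is the limit of
  \<open>denom n ones\<close>.\<close>

lemma one_plus_G_ones: "1 + m * G ones = (1 + m) / (1 - \<mu>)"
  using \<mu>_less_1 by (simp add: G_ones \<Lambda>_def \<mu>_def field_simps)

lemma G_add: "bvec v \<Longrightarrow> bvec w \<Longrightarrow> G (\<lambda>i. v i + w i) = G v + G w"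
  unfolding G_def x_def
  by (simp add: app_power_add[OF bM] dot_add[OF ng] app_power_bvec[OF bM] suminf_add[OF summable_x summable_x, unfolded x_def])

lemma V_add: "bvec v \<Longrightarrow> bvec w \<Longrightarrow> V (\<lambda>i. v i + w i) = V v + V w"
  unfolding V_def
  by (simp add: app_power_add[OF bH] dot_add[OF ng] app_power_bvec[OF bH] distrib_left suminf_add[OF summable_V summable_V])

lemma G_nonneg: "bvec w \<Longrightarrow> 0 \<le> G w"
  unfolding G_def by (intro suminf_nonneg summable_x x_nonneg)

text \<open>The two sides are the series of g H^n w with weights 1 and R^n. This inequality makes
  the limiting \<open>h\<close> non-negative.\<close>

lemma G_le_V: assumes w: "bvec w" shows "(1 - \<mu>) * G w \<le> V w"
  unfolding G_eq[OF w] V_def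
proof (intro suminf_le summable_H summable_V w)
  fix n
  have "1 * dot g (app_power H n w) \<le> R ^ n * dot g (app_power H n w)"
    using R_gt_1 by (intro mult_right_mono one_le_power dot_nonneg ng app_power_bvec bH w) auto
  then show "dot g (app_power H n w) \<le> R ^ n * dot g (app_power H n w)" by simp
qed

lemma vec_mat_neumann_inverse: "vec_mat g (neumann_inverse M) j = G (unit_col j)"
proof -
  let ?a = "\<lambda>k i. g i * app_power M k (unit_col j) i"
  have s: "summable (\<lambda>k. app_power M k (unit_col j) i)" for i
    using summable_of_geometric[OF app_power_M_limit[OF bvec_unit_col]] .
  have "(\<lambda>i. \<Sum>k. ?a k i) sums (\<Sum>k. \<Sum>i. ?a k i)"
  proof (rule tonelli_series(2))
    show "0 \<le> ?a k i" for k i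
      using nsumD(1)[OF ng] bvecD[OF app_power_bvec[OF bM bvec_unit_col]] by simp
    show "summable (?a k)" for k by (intro dot_summable ng app_power_bvec bM bvec_unit_col)
    show "summable (\<lambda>k. \<Sum>i. ?a k i)"
      using summable_x[OF bvec_unit_col, of j] by (simp add: x_def dot_def)
  qed
  then show ?thesis
    using s by (simp add: vec_mat_def neumann_inverse_def mat_power_eq_app G_def x_def dot_def sums_iff suminf_mult)
qed

lemma G_sums:
  assumes w: "bvec w" shows "(\<lambda>j. vec_mat g (neumann_inverse M) j * w j) sums G w"
proof -
  have 1: "(\<lambda>j. (\<Sum>k. 1 ^ k * (vec_mat g (mat_power M k) j * w j))) sums (\<Sum>k. 1 ^ k * dot g (app_power M k w))"
    using summable_x[OF w] by (intro power_series_vec_sums ng bM w) (auto simp: x_def)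
  have "(\<Sum>k. vec_mat g (mat_power M k) j * w j) = G (unit_col j) * w j" for j
    unfolding G_def x_def vec_mat_power
    by (rule suminf_mult2[symmetric, OF summable_x[OF bvec_unit_col, unfolded x_def]])
  then show ?thesis using 1 by (simp add: vec_mat_neumann_inverse) (simp add: G_def x_def)
qed

lemma V_sums:
  assumes w: "bvec w" shows "(\<lambda>j. (\<Sum>k. R ^ k * vec_mat g (mat_power H k) j) * w j) sums V w"
proof -
  have "(\<lambda>j. (\<Sum>k. R ^ k * (vec_mat g (mat_power H k) j * w j))) sums V w"
    unfolding V_def using R by (intro power_series_vec_sums ng bH w summable_V) auto
  moreover have "(\<Sum>k. R ^ k * (vec_mat g (mat_power H k) j * w j)) = (\<Sum>k. R ^ k * vec_mat g (mat_power H k) j) * w j" for j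
    unfolding vec_mat_power mult.assoc[symmetric]
    by (rule suminf_mult2[symmetric, OF summable_V[OF bvec_unit_col]])
  ultimately show ?thesis by simp
qed

end

section \<open>Generating functions of the process\<close>

lemma pgf_zero: "pgf q (\<lambda>_. 0) = pmf q {#}"
proof -
  have "(\<Prod>i\<in>#x. 0 :: real) = indicator {{#}} x" for x :: "nat multiset"
    by (cases x) (auto simp: indicator_def)
  then show ?thesis by (simp add: pgf_def measure_pmf_single)
qed

lemma pgf_cond_nonempty:
  assumes s: "unit_vec s" and pos: "pmf q {#} < 1"
  shows "pgf (cond_pmf q (- {{#}})) s = (pgf q s - pmf q {#}) / (1 - pmf q {#})"
proof -
  let ?f = "\<lambda>x. \<Prod>i\<in>#x. s i" and ?S = "- {{#}} :: nat multiset set"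
  have meas: "measure (measure_pmf q) ?S = 1 - pmf q {#}"
    using measure_pmf.prob_compl[of "{{#}}" q] by (simp add: measure_pmf_single Compl_eq_Diff_UNIV)
  have ne: "set_pmf q \<inter> ?S \<noteq> {}"
    using pos meas by (metis diff_gt_0_iff_gt less_irrefl measure_pmf_zero_iff)
  have f: "0 \<le> ?f x" "?f x \<le> 1" for x using prod_mset_unit[OF s] by auto
  have I: "0 \<le> ?f x * indicator ?S x" "?f x * indicator ?S x \<le> 1" for x
    using f[of x] by (auto simp: indicator_def)
  have "ennreal (pgf (cond_pmf q ?S) s) = (\<integral>\<^sup>+x. ennreal (?f x) \<partial>cond_pmf q ?S)"
    unfolding pgf_def by (intro nn_integral_eq_integral[symmetric] integrable_unit f) (auto simp: f)
  also have "\<dots> = (\<integral>\<^sup>+x. ennreal (?f x) * indicator ?S x \<partial>q) / emeasure (measure_pmf q) ?S"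
    unfolding cond_pmf.rep_eq[OF ne] by (intro nn_integral_uniform_measure) auto
  also have "(\<integral>\<^sup>+x. ennreal (?f x) * indicator ?S x \<partial>q) = (\<integral>\<^sup>+x. ennreal (?f x * indicator ?S x) \<partial>q)"
    by (intro nn_integral_cong) (auto simp: indicator_def)
  also have "\<dots> = ennreal (measure_pmf.expectation q (\<lambda>x. ?f x * indicator ?S x))"
    by (intro nn_integral_eq_integral integrable_unit I) (auto simp: I)
  also have "emeasure (measure_pmf q) ?S = ennreal (1 - pmf q {#})"
    by (simp add: measure_pmf.emeasure_eq_measure meas)
  also have "ennreal (measure_pmf.expectation q (\<lambda>x. ?f x * indicator ?S x)) / ennreal (1 - pmf q {#})
      = ennreal (measure_pmf.expectation q (\<lambda>x. ?f x * indicator ?S x) / (1 - pmf q {#}))"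
    using pos by (intro divide_ennreal integral_nonneg_AE) (auto simp: I)
  also have "measure_pmf.expectation q (\<lambda>x. ?f x * indicator ?S x) = pgf q s - pmf q {#}"
  proof -
    have "measure_pmf.expectation q (\<lambda>x. ?f x * indicator ?S x)
        = measure_pmf.expectation q (\<lambda>x. ?f x - indicator {{#}} x)"
      by (intro Bochner_Integration.integral_cong) (auto simp: indicator_def)
    also have "\<dots> = pgf q s - measure_pmf.expectation q (indicator {{#}})"
      unfolding pgf_def by (intro Bochner_Integration.integral_diff integrable_unit f) auto
    finally show ?thesis by (simp add: measure_pmf_single)
  qed
  finally have "ennreal (pgf (cond_pmf q ?S) s) = ennreal ((pgf q s - pmf q {#}) / (1 - pmf q {#}))" .
  moreover have "0 \<le> pgf q s - pmf q {#}"
  proof -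
    have "pmf q {#} = measure_pmf.expectation q (indicator {{#}})" by (simp add: measure_pmf_single)
    also have "\<dots> \<le> pgf q s" unfolding pgf_def
      by (intro integral_mono integrable_unit f) (auto simp: indicator_def f)
    finally show ?thesis by simp
  qed
  ultimately show ?thesis
    using pos by (subst (asm) ennreal_inj) (auto simp: pgf_unit[OF s])
qed

text \<open>The mean is a one-sided derivative of the generating function at 1. The difference
  quotient (1 - (1 - t)^c) / t is the sum of (1 - t)^k over k < c, which increases to c as t
  decreases to 0, so monotone convergence applies without prior knowledge that the mean is
  finite.\<close>

lemma expectation_count_of_pgf:
  assumes lim: "\<And>t. 0 < t \<Longrightarrow> t \<le> 1 \<Longrightarrow> pgf q (\<lambda>l. 1 - t * id_mat l j) = 1 - t * F t"
    and F: "(F \<longlongrightarrow> c) (at_right 0)"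
  shows "measure_pmf.expectation q (\<lambda>x. real (count x j)) = c"
proof -
  define t where "t = (\<lambda>n. 1 / real (Suc n))"
  have t: "0 < t n" "t n \<le> 1" for n by (auto simp: t_def)
  have t0: "t \<longlonglongrightarrow> 0" unfolding t_def by (rule LIMSEQ_inverse_real_of_nat[unfolded inverse_eq_divide])
  have "filterlim t (at_right 0) sequentially"
    using t0 t by (intro tendsto_imp_filterlim_at_right) auto
  with F have Ft: "(\<lambda>n. F (t n)) \<longlonglongrightarrow> c" by (rule filterlim_compose)
  define \<phi> where "\<phi> = (\<lambda>n x. \<Sum>k<count x j. (1 - t n) ^ k)"
  have prod: "(\<Prod>l\<in>#x. 1 - r * id_mat l j) = (1 - r) ^ count x j" for x :: "nat multiset" and r :: real
    by (induction x) (auto simp: id_mat_def)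
  have \<phi>: "\<phi> n x = (1 - (1 - t n) ^ count x j) / t n" for n x
    using one_diff_power_eq[of "1 - t n" "count x j"] t[of n] by (simp add: \<phi>_def field_simps)
  have int0: "integrable (measure_pmf q) (\<lambda>x. (1 - t n) ^ count x j)" for n
    by (intro integrable_unit) (use t[of n] in \<open>auto intro: power_le_one\<close>)
  have E\<phi>: "measure_pmf.expectation q (\<phi> n) = F (t n)" for n
  proof -
    have "measure_pmf.expectation q (\<phi> n) = (1 - measure_pmf.expectation q (\<lambda>x. (1 - t n) ^ count x j)) / t n"
      unfolding \<phi> using int0[of n] by simp
    also have "measure_pmf.expectation q (\<lambda>x. (1 - t n) ^ count x j) = 1 - t n * F (t n)"
      using lim[OF t] by (simp add: pgf_def prod)
    finally show ?thesis using t[of n] by simp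
  qed
  show ?thesis
  proof (rule integral_monotone_convergence[of "measure_pmf q" \<phi>])
    show "integrable (measure_pmf q) (\<phi> n)" for n unfolding \<phi> using int0[of n] by simp
    show "AE x in measure_pmf q. mono (\<lambda>n. \<phi> n x)"
      unfolding \<phi>_def t_def by (intro AE_I2 monoI sum_mono power_mono) (auto simp: frac_le)
    show "AE x in measure_pmf q. (\<lambda>n. \<phi> n x) \<longlonglongrightarrow> real (count x j)"
    proof (intro AE_I2)
      fix x
      have "(\<lambda>n. \<phi> n x) \<longlonglongrightarrow> (\<Sum>k<count x j. (1 - 0) ^ k)"
        unfolding \<phi>_def by (intro tendsto_intros t0)
      then show "(\<lambda>n. \<phi> n x) \<longlonglongrightarrow> real (count x j)" by simp
    qed
    show "(\<lambda>n. measure_pmf.expectation q (\<phi> n)) \<longlonglongrightarrow> c" unfolding E\<phi> by (rule Ft)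
  qed auto
qed

lemma unit_vec_compl: "unit_vec s \<Longrightarrow> unit_vec (\<lambda>j. 1 - s j)"
  by (auto simp: unit_vec_def)

context lf_params
begin

text \<open>In the variable \<open>t = 1 - s\<close> a linear-fractional generating function becomes homogeneous,
  so that its iterates are explicit.\<close>

lemma pgf_offspring:
  assumes q: "LF q (H i) g m" and t: "unit_vec t"
  shows "pgf q (\<lambda>j. 1 - t j) = 1 - app M t i / (1 + m * dot g t)"
proof -
  have bt: "bvec t" and bs: "bvec (\<lambda>j. 1 - t j)"
    using t unit_vec_compl unit_vec_imp_bvec by blast+
  have compl: "dot y (\<lambda>j. 1 - t j) = suminf y - dot y t" if "nsum y" for y
    using dot_add[OF that bt bs] by (simp add: dot_ones)
  have "pgf q (\<lambda>j. 1 - t j) = 1 - suminf (H i) + dot (H i) (\<lambda>j. 1 - t j) / (1 + m - m * dot g (\<lambda>j. 1 - t j))"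
    using q unit_vec_compl[OF t] unfolding LF_def pgf_def dot_def unit_vec_def by auto
  also have "\<dots> = 1 - app H ones i + (app H ones i - app H t i) / (1 + m * dot g t)"
    by (simp add: compl bmatD[OF bH] ng sum_g right_diff_distrib) (simp add: app_def dot_ones)
  also have "\<dots> = 1 - app M t i / (1 + m * dot g t)"
  proof -
    have "0 < 1 + m * dot g t" using m dot_nonneg[OF ng bt] by (simp add: add_pos_nonneg)
    then show ?thesis unfolding app_M[OF bt] by (simp add: field_simps)
  qed
  finally show ?thesis .
qed

definition denom :: "nat \<Rightarrow> rvec \<Rightarrow> real" where
  "denom n t = 1 + m * (\<Sum>k<n. x k t)"

lemma denom_pos: "bvec t \<Longrightarrow> 0 < denom n t"
  unfolding denom_def using m by (intro add_pos_nonneg mult_nonneg_nonneg sum_nonneg x_nonneg) auto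

text \<open>The induction substitutes the offspring generating functions, replacing t by t' = M t /
  (1 + m g t). As t' is a scalar multiple of M t, linearity pulls the scalar out of the numerator,
  and 1 + m g t supplies the new k = 0 term of the denominator.\<close>

lemma pgf_gen_law:
  assumes off: "\<And>i. LF (off i) (H i) g m" and t: "unit_vec t"
  shows "pgf (gen_law off i n) (\<lambda>j. 1 - t j) = 1 - app_power M n t i / denom n t"
  using t
proof (induction n arbitrary: t)
  case 0
  then show ?case by (simp add: pgf_def denom_def)
next
  case (Suc n)
  let ?D = "1 + m * dot g t"
  have bt: "bvec t" using Suc.prems by (rule unit_vec_imp_bvec)
  have D: "0 < ?D" using m dot_nonneg[OF ng bt] by (simp add: add_pos_nonneg)
  define t' where "t' = (\<lambda>j. 1 / ?D * app M t j)"
  have off_t: "pgf (off j) (\<lambda>j. 1 - t j) = 1 - t' j" for j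
    using pgf_offspring[OF off Suc.prems] by (simp add: t'_def)
  \<comment> \<open>Each \<open>1 - t' j\<close> is a value of a generating function, so it lies in
    [0, 1].\<close>
  have "unit_vec t'"
    unfolding unit_vec_def using pgf_unit[OF unit_vec_compl[OF Suc.prems], of "off _"] off_t
    by (metis add_le_cancel_left diff_ge_0_iff_ge diff_add_cancel add.commute)
  from Suc.IH[OF this]
  have "pgf (gen_law off i (Suc n)) (\<lambda>j. 1 - t j) = 1 - app_power M n t' i / denom n t'"
    by (simp only: pgf_gen_law_Suc[OF unit_vec_compl[OF Suc.prems]] off_t)
  moreover have bMt: "bvec (app M t)" by (intro app_bvec bM bt)
  have P: "app_power M k t' = (\<lambda>i. 1 / ?D * app_power M (Suc k) t i)" for k
    unfolding t'_def app_power_scale[OF bM bMt] by (simp add: funpow_swap1)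
  have xS: "x k t' = 1 / ?D * x (Suc k) t" for k
    unfolding x_def P by (intro dot_scale ng app_power_bvec bM bt)
  have denom': "denom n t' = denom (Suc n) t / ?D"
  proof -
    have "denom n t' = 1 + m * (1 / ?D * (\<Sum>k<n. x (Suc k) t))"
      by (simp only: denom_def xS sum_distrib_left)
    also have "\<dots> = (?D + m * (\<Sum>k<n. x (Suc k) t)) / ?D"
      using D by (simp add: field_simps)
    also have "?D + m * (\<Sum>k<n. x (Suc k) t) = denom (Suc n) t"
      unfolding denom_def sum.lessThan_Suc_shift by (simp add: x_def algebra_simps)
    finally show ?thesis .
  qed
  then have "app_power M n t' i / denom n t' = app_power M (Suc n) t i / denom (Suc n) t"
    using D unfolding P by simp
  ultimately show ?case by simp
qed

lemma expectation_count_offspring: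
  assumes off: "\<And>i. LF (off i) (H i) g m"
  shows "measure_pmf.expectation (gen_law off i 1) (\<lambda>x. real (count x j)) = M i j"
proof (rule expectation_count_of_pgf)
  fix t :: real assume t: "0 < t" "t \<le> 1"
  have u: "unit_vec (\<lambda>l. t * id_mat l j)" using t by (auto simp: unit_vec_def id_mat_def)
  have "app M (\<lambda>l. t * id_mat l j) i = t * M i j"
    by (simp add: app_scale[OF bM bvec_unit_col]) (simp add: app_def dot_unit_col)
  moreover have "dot g (\<lambda>l. t * id_mat l j) = t * g j"
    by (simp add: dot_scale[OF ng bvec_unit_col] dot_unit_col)
  ultimately show "pgf (gen_law off i 1) (\<lambda>l. 1 - t * id_mat l j) = 1 - t * (M i j / (1 + m * (t * g j)))"
    using pgf_gen_law[OF off u, of i 1] by (simp add: denom_def x_def)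
next
  have "((\<lambda>t. M i j / (1 + m * (t * g j))) \<longlongrightarrow> M i j / (1 + m * (0 * g j))) (at_right 0)"
    by (intro tendsto_intros) auto
  then show "((\<lambda>t. M i j / (1 + m * (t * g j))) \<longlongrightarrow> M i j) (at_right 0)" by simp
qed

lemma extinction:
  assumes off: "\<And>i. LF (off i) (H i) g m"
  shows "pmf (gen_law off i n) {#} = 1 - app_power M n ones i / denom n ones"
  using pgf_gen_law[OF off, of ones i n] by (simp add: pgf_zero unit_vec_def)

end

section \<open>Survival probability and conditional limit law\<close>

context lf_subcritical
begin

lemma denom_limit: "bvec t \<Longrightarrow> (\<lambda>n. denom n t) \<longlonglongrightarrow> 1 + m * G t"
  unfolding denom_def G_def
  by (intro tendsto_add tendsto_const tendsto_mult_left summable_LIMSEQ summable_x)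

lemma scaled_survival_limit:
  assumes t: "bvec t"
  shows "(\<lambda>n. R ^ n * (app_power M n t i / denom n t)) \<longlonglongrightarrow> m * S i * (V t / \<beta>) / (1 + m * G t)"
proof -
  have "1 + m * G t \<noteq> 0" using m G_nonneg[OF t] by (metis add_pos_nonneg less_irrefl less_numeral_extra(1) mult_nonneg_nonneg less_imp_le)
  then have "(\<lambda>n. (R ^ n * app_power M n t i) / denom n t) \<longlonglongrightarrow> m * S i * (V t / \<beta>) / (1 + m * G t)"
    by (intro tendsto_divide app_power_M_limit denom_limit t)
  then show ?thesis by (simp only: times_divide_eq_right)
qed

lemma survival_limit:
  "(\<lambda>n. R ^ n * (app_power M n ones i / denom n ones)) \<longlonglongrightarrow> (1 - \<mu>) * S i / \<beta>"
proof -
  have "m * S i * (V ones / \<beta>) / (1 + m * G ones) = (1 - \<mu>) * S i / \<beta>"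
    unfolding V_ones one_plus_G_ones using m \<mu>_less_1 \<beta>_pos by (simp add: divide_simps)
  then show ?thesis using scaled_survival_limit[OF bvec_ones, of i] by simp
qed

definition limit_h :: rvec where
  "limit_h j = (1 + m) / (1 - \<mu>) * (m / (1 + m) * (\<Sum>k. R ^ k * vec_mat g (mat_power H k) j))
    - m * vec_mat g (neumann_inverse M) j"

definition limit_g :: rvec where
  "limit_g j = (1 - \<mu>) / \<Lambda> * vec_mat g (neumann_inverse M) j"

lemma limit_h_sums: assumes w: "bvec w" shows "(\<lambda>j. limit_h j * w j) sums (m / (1 - \<mu>) * V w - m * G w)"
proof -
  have "(\<lambda>j. m / (1 - \<mu>) * ((\<Sum>k. R ^ k * vec_mat g (mat_power H k) j) * w j)
      - m * (vec_mat g (neumann_inverse M) j * w j)) sums (m / (1 - \<mu>) * V w - m * G w)"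
    by (intro sums_diff sums_mult V_sums G_sums w)
  moreover have "(1 + m) / (1 - \<mu>) * (m / (1 + m)) = m / (1 - \<mu>)" using m by simp
  then have "limit_h j * w j = m / (1 - \<mu>) * ((\<Sum>k. R ^ k * vec_mat g (mat_power H k) j) * w j)
      - m * (vec_mat g (neumann_inverse M) j * w j)" for j
    unfolding limit_h_def mult.assoc[symmetric] by (simp only: left_diff_distrib mult.assoc)
  ultimately show ?thesis by simp
qed

lemma limit_g_sums: assumes w: "bvec w" shows "(\<lambda>j. limit_g j * w j) sums ((1 - \<mu>) / \<Lambda> * G w)"
  using sums_mult[OF G_sums[OF w], of "(1 - \<mu>) / \<Lambda>"] by (simp add: limit_g_def mult.assoc)

lemma prob_vec_limit_h: "prob_vec limit_h"
proof -
  have "m / (1 - \<mu>) * V ones - m * G ones = (1 + m) / (1 - \<mu>) - m * G ones"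
    using m by (simp add: V_ones)
  also have "\<dots> = 1" by (simp flip: one_plus_G_ones)
  finally have "limit_h sums 1" using limit_h_sums[OF bvec_ones] by simp
  moreover have "0 \<le> limit_h j" for j
  proof -
    have "G (unit_col j) \<le> V (unit_col j) / (1 - \<mu>)"
      using G_le_V[OF bvec_unit_col, of j] \<mu>_less_1 by (simp add: pos_le_divide_eq mult.commute)
    from mult_left_mono[OF this, of m] m have "m * G (unit_col j) \<le> m / (1 - \<mu>) * V (unit_col j)" by simp
    moreover have "limit_h j = m / (1 - \<mu>) * V (unit_col j) - m * G (unit_col j)"
      using limit_h_sums[OF bvec_unit_col, of j] sums_unique dot_unit_col[of limit_h j]
      unfolding dot_def by metis
    ultimately show ?thesis by simp
  qed
  ultimately show ?thesis by (simp add: prob_vec_def)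
qed

lemma prob_vec_limit_g: "prob_vec limit_g"
proof -
  have "(1 - \<mu>) / \<Lambda> * G ones = 1" using \<mu>_less_1 \<Lambda>_pos by (simp add: G_ones)
  with limit_g_sums[OF bvec_ones] have "limit_g sums 1" by (simp only: mult_1_right)
  moreover have "0 \<le> limit_g j" for j
    using \<mu>_less_1 \<Lambda>_pos G_nonneg[OF bvec_unit_col, of j] by (simp add: limit_g_def vec_mat_neumann_inverse)
  ultimately show ?thesis by (simp add: prob_vec_def)
qed

text \<open>The conditional generating function is 1 minus the quotient of two sequences of the same
  order R^{-n}. Their limits share the factor S_i / \<beta>, so the initial type disappears.
  Returning from t to s = 1 - t, the linearity of V and G brings the quotient into linear-fractional
  form.\<close>

lemma conditional_limit:
  assumes off: "\<And>i. LF (off i) (H i) g m"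
    and Y: "LF Y limit_h limit_g (m * \<Lambda> / (1 - \<mu>))"
  shows "(\<lambda>n. pmf (cond_pmf (gen_law off i n) (- {{#}})) k) \<longlonglongrightarrow> pmf Y k"
proof (rule pmf_tendsto_of_pgf)
  fix s :: "nat \<Rightarrow> real" assume "\<forall>i. 0 \<le> s i \<and> s i \<le> 1"
  then have s: "unit_vec s" by (simp add: unit_vec_def)
  define t where "t = (\<lambda>j. 1 - s j)"
  have t: "unit_vec t" unfolding t_def by (rule unit_vec_compl[OF s])
  have bs: "bvec s" and bt: "bvec t" using s t by (auto intro: unit_vec_imp_bvec)
  have Vt: "V t = (1 + m) / m - V s" using V_add[OF bt bs] V_ones by (simp add: t_def)
  have Gt: "G t = G ones - G s" using G_add[OF bt bs] by (simp add: t_def)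
  let ?c = "(1 + m) / (1 - \<mu>)"
  have D: "1 + m * G t = ?c - m * G s"
    using one_plus_G_ones by (simp add: Gt right_diff_distrib)
  have Dpos: "0 < 1 + m * G t" using m G_nonneg[OF bt] by (simp add: add_pos_nonneg)
  let ?\<sigma> = "\<lambda>n. app_power M n ones i / denom n ones" and ?a = "\<lambda>n. app_power M n t i / denom n t"
  have \<sigma>: "0 < ?\<sigma> n" for n using app_power_M_ones_pos denom_pos[OF bvec_ones] by simp
  have cond: "pgf (cond_pmf (gen_law off i n) (- {{#}})) s = 1 - (R ^ n * ?a n) / (R ^ n * ?\<sigma> n)" for n
  proof -
    have "pgf (gen_law off i n) s = 1 - ?a n"
      using pgf_gen_law[OF off t, of i n] by (simp add: t_def)
    moreover have "pmf (gen_law off i n) {#} < 1" using \<sigma>[of n] by (simp add: extinction[OF off])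
    ultimately have "pgf (cond_pmf (gen_law off i n) (- {{#}})) s = (?\<sigma> n - ?a n) / ?\<sigma> n"
      using pgf_cond_nonempty[OF s, of "gen_law off i n"] by (simp add: extinction[OF off])
    also have "\<dots> = 1 - ?a n / ?\<sigma> n" using \<sigma>[of n] unfolding diff_divide_distrib by (metis divide_self less_irrefl)
    also have "?a n / ?\<sigma> n = (R ^ n * ?a n) / (R ^ n * ?\<sigma> n)"
      using R by (intro mult_divide_mult_cancel_left[symmetric]) simp
    finally show ?thesis .
  qed
  have "(1 - \<mu>) * S i / \<beta> \<noteq> 0" using \<mu>_less_1 S_pos[of i] \<beta>_pos by simp
  then have "(\<lambda>n. 1 - (R ^ n * ?a n) / (R ^ n * ?\<sigma> n)) \<longlonglongrightarrow>
      1 - (m * S i * (V t / \<beta>) / (1 + m * G t)) / ((1 - \<mu>) * S i / \<beta>)"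
    by (intro tendsto_diff tendsto_const tendsto_divide scaled_survival_limit[OF bt] survival_limit)
  also have "1 - (m * S i * (V t / \<beta>) / (1 + m * G t)) / ((1 - \<mu>) * S i / \<beta>)
      = 1 - m / (1 - \<mu>) * V t / (1 + m * G t)"
  proof -
    have cancel: "(a * s * (v / b) / c) / (e * s / b) = a / e * v / c"
      if "s \<noteq> 0" "b \<noteq> 0" "c \<noteq> 0" "e \<noteq> 0" for a s v b c e :: real
      using that by (simp add: field_simps)
    show ?thesis using S_pos[of i] \<beta>_pos \<mu>_less_1 Dpos by (subst cancel) auto
  qed
  also have "\<dots> = (1 + m * G t - m / (1 - \<mu>) * V t) / (1 + m * G t)"
    using Dpos by (simp add: diff_divide_distrib)
  also have "\<dots> = (m / (1 - \<mu>) * V s - m * G s) / (?c - m * G s)"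
    unfolding D Vt using m by (simp add: right_diff_distrib)
  also have "\<dots> = pgf Y s"
  proof -
    have "pgf Y s = (1 - (\<Sum>i. limit_h i)) + (\<Sum>i. limit_h i * s i) /
        (1 + m * \<Lambda> / (1 - \<mu>) - m * \<Lambda> / (1 - \<mu>) * (\<Sum>i. limit_g i * s i))"
      using Y s unfolding LF_def pgf_def unit_vec_def by blast
    also have "(\<Sum>i. limit_h i) = 1" using prob_vec_limit_h by (simp add: prob_vec_def sums_iff)
    also have "(\<Sum>i. limit_h i * s i) = m / (1 - \<mu>) * V s - m * G s"
      using limit_h_sums[OF bs] by (simp add: sums_iff)
    also have "m * \<Lambda> / (1 - \<mu>) * (\<Sum>i. limit_g i * s i) = m * G s"
      using limit_g_sums[OF bs] \<Lambda>_pos \<mu>_less_1 by (simp add: sums_iff)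
    also have "1 + m * \<Lambda> / (1 - \<mu>) = ?c" using one_plus_G_ones by (simp add: G_ones)
    finally show ?thesis by simp
  qed
  finally show "(\<lambda>n. measure_pmf.expectation (cond_pmf (gen_law off i n) (- {{#}})) (\<lambda>x. \<Prod>i\<in>#x. s i))
      \<longlonglongrightarrow> measure_pmf.expectation Y (\<lambda>x. \<Prod>i\<in>#x. s i)"
    unfolding cond[symmetric] by (simp add: pgf_def)
qed

end

section \<open>The Malthusian parameter and the theorem\<close>

context lf_params
begin

lemma d_power_nonneg: "0 \<le> s \<Longrightarrow> 0 \<le> d n * s ^ k"
  by (intro mult_nonneg_nonneg d_nonneg zero_le_power)

lemma f_gen_eq: "0 \<le> s \<Longrightarrow> f_gen H g (ennreal s) = (\<Sum>n. ennreal (d (Suc n) * s ^ Suc n))"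
  unfolding f_gen_def d_seq_eq by (simp only: ennreal_mult' ennreal_power d_nonneg zero_le_power)

lemma f_gen_mono: "s \<le> t \<Longrightarrow> f_gen H g s \<le> f_gen H g t"
  unfolding f_gen_def by (intro suminf_le mult_left_mono power_mono) auto

lemma f_gen_summable:
  "0 \<le> s \<Longrightarrow> summable (\<lambda>n. d (Suc n) * s ^ Suc n) \<Longrightarrow>
    f_gen H g (ennreal s) = ennreal (\<Sum>n. d (Suc n) * s ^ Suc n)"
  unfolding f_gen_eq by (intro suminf_ennreal2 d_power_nonneg)

lemma summable_of_f_gen:
  "0 \<le> s \<Longrightarrow> f_gen H g (ennreal s) \<noteq> \<infinity> \<Longrightarrow> summable (\<lambda>n. d (Suc n) * s ^ Suc n)"
  unfolding f_gen_eq by (intro summable_suminf_not_top d_power_nonneg) auto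

lemma sums_of_f_gen:
  assumes "0 \<le> s" "f_gen H g (ennreal s) = ennreal c" "0 \<le> c"
  shows "(\<lambda>n. d (Suc n) * s ^ Suc n) sums c"
proof -
  have s: "summable (\<lambda>n. d (Suc n) * s ^ Suc n)" using assms by (intro summable_of_f_gen) auto
  then have "ennreal (\<Sum>n. d (Suc n) * s ^ Suc n) = ennreal c" using f_gen_summable[OF assms(1)] assms(2) by simp
  then have "(\<Sum>n. d (Suc n) * s ^ Suc n) = c"
    using assms s suminf_nonneg[OF s d_power_nonneg] by (subst (asm) ennreal_inj)
  then show ?thesis using s by (simp add: sums_iff)
qed

text \<open>Two equal finite values at s < t force every d_n with n \<ge> 1 to vanish, and then the
  common value is 0.\<close>

lemma f_gen_inj:
  assumes "0 < s" "s < t" "f_gen H g (ennreal s) = ennreal c" "f_gen H g (ennreal t) = ennreal c" "0 < c"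
  shows False
proof -
  have S: "(\<lambda>n. d (Suc n) * s ^ Suc n) sums c" and T: "(\<lambda>n. d (Suc n) * t ^ Suc n) sums c"
    using assms sums_of_f_gen[of s c] sums_of_f_gen[of t c] by linarith+
  have "(\<lambda>n. d (Suc n) * t ^ Suc n - d (Suc n) * s ^ Suc n) sums 0"
    using sums_diff[OF T S] by simp
  moreover have "0 \<le> d (Suc n) * t ^ Suc n - d (Suc n) * s ^ Suc n" for n
    using assms d_nonneg[of "Suc n"] mult_left_mono[OF power_mono[of s t "Suc n"]] by simp
  ultimately have "d (Suc n) * t ^ Suc n - d (Suc n) * s ^ Suc n = 0" for n
    using suminf_eq_zero_iff[of "\<lambda>n. d (Suc n) * t ^ Suc n - d (Suc n) * s ^ Suc n"] by (auto simp: sums_iff)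
  moreover have "s ^ Suc n < t ^ Suc n" for n
    using assms by (intro power_strict_mono) auto
  ultimately have "d (Suc n) = 0" for n
    by (metis diff_eq_diff_eq diff_self less_irrefl mult_cancel_left)
  then show False using S assms(5) sums_unique2[OF sums_zero, of c] by simp
qed

text \<open>The root is the supremum of all \<open>s\<close> with \<open>m f(s) \<le> 1\<close>: closedness gives one inequality; the
  other follows from continuity of the power series if the supremum lies below \<open>R\<^sub>f\<close>, and from
  the hypothesis otherwise.\<close>

lemma f_gen_root:
  assumes ge: "ennreal (1 / m) \<le> f_gen H g (R_f H g)"
  obtains s where "0 < s" "f_gen H g (ennreal s) = ennreal (1 / m)"
proof -
  obtain N where N: "0 < d (Suc N)"
  proof (rule ccontr)
    assume "\<not> thesis"
    with that have "d (Suc n) = 0" for n using d_nonneg[of "Suc n"] by (metis less_eq_real_def)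
    then have "f_gen H g (R_f H g) = 0" unfolding f_gen_def d_seq_eq by simp
    then show False using ge m by simp
  qed
  define A where "A = {s. 0 \<le> s \<and> f_gen H g (ennreal s) \<le> ennreal (1 / m)}"
  have partial: "(\<Sum>n<k. d (Suc n) * s ^ Suc n) \<le> 1 / m" if "s \<in> A" for s k
  proof -
    have s: "0 \<le> s" "f_gen H g (ennreal s) \<le> ennreal (1 / m)" using that by (auto simp: A_def)
    then have "f_gen H g (ennreal s) \<noteq> \<infinity>" by (metis ennreal_neq_top infinity_ennreal_def top_unique)
    then have sm: "summable (\<lambda>n. d (Suc n) * s ^ Suc n)" by (rule summable_of_f_gen[OF s(1)])
    have "(\<Sum>n<k. d (Suc n) * s ^ Suc n) \<le> (\<Sum>n. d (Suc n) * s ^ Suc n)"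
      using s(1) d_nonneg by (intro sum_le_suminf sm) auto
    also have "\<dots> \<le> 1 / m"
      using s(2) m unfolding f_gen_summable[OF s(1) sm] by (subst (asm) ennreal_le_iff) auto
    finally show ?thesis .
  qed
  have A0: "0 \<in> A" using f_gen_summable[of 0] by (auto simp: A_def)
  \<comment> \<open>A single positive coefficient bounds \<open>A\<close>: for s > 1 one has d (Suc
    N) s \<le> d (Suc N) s^{N+1} \<le> 1/m.\<close>
  have "s \<le> max 1 (1 / (m * d (Suc N)))" if s: "s \<in> A" for s
  proof (cases "s \<le> 1")
    case False
    have "d (Suc N) * s \<le> d (Suc N) * s ^ Suc N"
      using False N by (intro mult_left_mono self_le_power) auto
    also have "\<dots> \<le> (\<Sum>n<Suc N. d (Suc n) * s ^ Suc n)"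
      using s d_nonneg by (intro member_le_sum[of N "{..<Suc N}" "\<lambda>n. d (Suc n) * s ^ Suc n"]) (auto simp: A_def)
    also have "\<dots> \<le> 1 / m" by (rule partial[OF s])
    finally have "s \<le> 1 / (m * d (Suc N))" using N m by (simp add: field_simps)
    then show ?thesis by simp
  qed simp
  then have bdd: "bdd_above A" by (auto simp: bdd_above_def)
  define s where "s = Sup A"
  have s0: "0 \<le> s" unfolding s_def by (rule cSup_upper[OF A0 bdd])
  \<comment> \<open>The partial sums are polynomials, so the bound carries over to the supremum
    before the convergence of the series there is known.\<close>
  have partial_s: "(\<Sum>n<k. d (Suc n) * s ^ Suc n) \<le> 1 / m" for k
  proof -
    have "closed {s. (\<Sum>n<k. d (Suc n) * s ^ Suc n) \<le> 1 / m}"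
      by (intro closed_Collect_le continuous_intros)
    then have "closure A \<subseteq> {s. (\<Sum>n<k. d (Suc n) * s ^ Suc n) \<le> 1 / m}"
      using partial by (intro closure_minimal) auto
    moreover have "s \<in> closure A" unfolding s_def using A0 bdd by (intro closure_contains_Sup) auto
    ultimately show ?thesis by blast
  qed
  have sms: "summable (\<lambda>n. d (Suc n) * s ^ Suc n)"
    by (rule bounded_imp_summable[OF d_power_nonneg[OF s0]]) (unfold lessThan_Suc_atMost[symmetric], rule partial_s)
  have fs: "f_gen H g (ennreal s) = ennreal (\<Sum>n. d (Suc n) * s ^ Suc n)" by (rule f_gen_summable[OF s0 sms])
  have le: "(\<Sum>n. d (Suc n) * s ^ Suc n) \<le> 1 / m" using partial_s by (intro suminf_le_const sms)
  have "\<not> (\<Sum>n. d (Suc n) * s ^ Suc n) < 1 / m"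
  proof
    assume lt: "(\<Sum>n. d (Suc n) * s ^ Suc n) < 1 / m"
    have "ennreal s < R_f H g"
    proof (rule ccontr)
      assume "\<not> ?thesis"
      then have "ennreal (1 / m) \<le> f_gen H g (ennreal s)"
        using ge f_gen_mono[of "R_f H g" "ennreal s"] by (simp add: not_less)
      then show False using lt m unfolding fs by (simp add: ennreal_le_iff2)
    qed
    then obtain z where z: "ennreal s < z" "z < R_f H g" using dense by blast
    then obtain t where t: "0 \<le> t" "z = ennreal t" by (cases z) auto
    have st: "s < t" using z t s0 by (simp add: ennreal_less_iff)
    have "f_gen H g (ennreal t) \<noteq> \<infinity>"
    proof
      assume "f_gen H g (ennreal t) = \<infinity>"
      then have "R_f H g \<le> ennreal t" unfolding R_f_def using st s0 by (intro Inf_lower) auto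
      then show False using z t by simp
    qed
    then have "summable (\<lambda>n. d (Suc n) * t ^ Suc n)" by (rule summable_of_f_gen[OF t(1)])
    then have "summable (\<lambda>n. d (Suc n) * t ^ Suc n * (1 / t))" by (rule summable_mult2)
    then have smt: "summable (\<lambda>n. d (Suc n) * t ^ n)" using st s0 by simp
    define F where "F = (\<lambda>r. r * (\<Sum>n. d (Suc n) * r ^ n))"
    have F: "F r = (\<Sum>n. d (Suc n) * r ^ Suc n) \<and> summable (\<lambda>n. d (Suc n) * r ^ Suc n)"
      if "0 \<le> r" "r < t" for r
    proof -
      have sr: "summable (\<lambda>n. d (Suc n) * r ^ n)" using powser_inside[OF smt, of r] that by simp
      show ?thesis using suminf_mult[OF sr, of r] summable_mult[OF sr, of r] by (simp add: F_def ac_simps)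
    qed
    have "isCont F s" unfolding F_def
      using isCont_powser[OF smt, of s] st s0 by (intro continuous_intros) auto
    then have "(F \<longlongrightarrow> F s) (at_right s)" unfolding isCont_def by (rule filterlim_mono) (auto simp: at_within_le_at)
    moreover have "F s < 1 / m" using F[OF s0 st] lt by simp
    ultimately have "\<forall>\<^sub>F r in at_right s. F r < 1 / m" by (rule order_tendstoD(2))
    moreover have "\<forall>\<^sub>F r in at_right s. r < t" by (rule order_tendstoD(2)[OF tendsto_ident_at st])
    ultimately have "\<forall>\<^sub>F r in at_right s. F r < 1 / m \<and> r < t \<and> s < r"
      using eventually_at_right_less[of s] by eventually_elim auto
    then obtain r where r: "F r < 1 / m" "r < t" "s < r"
      using eventually_happens[of _ "at_right s"] by auto
    then have "r \<in> A" using F[of r] s0 m f_gen_summable[of r] by (auto simp: A_def ennreal_le_iff2)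
    then have "r \<le> s" unfolding s_def by (intro cSup_upper bdd)
    then show False using r by simp
  qed
  then have root: "f_gen H g (ennreal s) = ennreal (1 / m)" using le unfolding fs by simp
  moreover have "s \<noteq> 0"
  proof
    assume "s = 0"
    then have "f_gen H g (ennreal s) = 0" using f_gen_summable[of 0] by simp
    then show False using root m by simp
  qed
  ultimately show ?thesis using that[of s] s0 by linarith
qed

text \<open>Finite \<beta> excludes the branch \<alpha> = -\<infinity>. In the other branch
  \<open>f_gen_root\<close> gives existence and \<open>f_gen_inj\<close> uniqueness, so the definite
  description denotes - ln s for the root s.\<close>

lemma R_of_beta_finite:
  assumes fin: "lf_beta H g m < \<infinity>"
  shows "0 < lf_R H g m" "lf_rho H g m = 1 / lf_R H g m"
    "f_gen H g (ennreal (lf_R H g m)) = ennreal (1 / m)"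
    "summable (\<lambda>n. real (Suc n) * d (Suc n) * lf_R H g m ^ Suc n)"
    "enn2real (lf_beta H g m) = m * (\<Sum>n. real (Suc n) * d (Suc n) * lf_R H g m ^ Suc n)"
proof -
  let ?R = "lf_R H g m"
  have ge: "ennreal (1 / m) \<le> f_gen H g (R_f H g)"
    using fin unfolding lf_beta_def by (auto split: if_splits)
  obtain s where s: "0 < s" "f_gen H g (ennreal s) = ennreal (1 / m)" using f_gen_root[OF ge] .
  have m_iff: "ennreal m * y = 1 \<longleftrightarrow> y = ennreal (1 / m)" for y
  proof
    assume *: "ennreal m * y = 1"
    then obtain r where r: "y = ennreal r" "0 \<le> r" using m by (cases y) (auto simp: ennreal_mult_top)
    then have "m * r = 1" using * m by (simp flip: ennreal_mult' ennreal_1)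
    then show "y = ennreal (1 / m)" using r m by (simp add: field_simps)
  qed (use m in \<open>simp flip: ennreal_mult'\<close>)
  have "(THE a. ennreal m * f_gen H g (ennreal (exp (- a))) = 1) = - ln s"
  proof (rule the_equality)
    show "ennreal m * f_gen H g (ennreal (exp (- (- ln s)))) = 1" using s by (simp add: m_iff)
    fix a assume "ennreal m * f_gen H g (ennreal (exp (- a))) = 1"
    then have a: "f_gen H g (ennreal (exp (- a))) = ennreal (1 / m)" by (simp add: m_iff)
    have "exp (- a) = s"
    proof (rule ccontr)
      assume "exp (- a) \<noteq> s"
      then consider "exp (- a) < s" | "s < exp (- a)" by linarith
      then show False using f_gen_inj[OF _ _ a s(2)] f_gen_inj[OF s(1) _ s(2) a] m by cases auto
    qed
    then show "a = - ln s" by auto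
  qed
  then have \<alpha>: "lf_alpha H g m = ereal (- ln s)" using ge by (simp add: lf_alpha_def)
  then have Rs: "?R = s" using s by (simp add: lf_R_def)
  show "0 < ?R" "lf_rho H g m = 1 / ?R" "f_gen H g (ennreal ?R) = ennreal (1 / m)"
    using s \<alpha> Rs by (auto simp: lf_rho_def exp_minus inverse_eq_divide)
  have pow: "exp (- (real_of_ereal (lf_alpha H g m) * real (Suc n))) = ?R ^ Suc n" for n
    using s unfolding \<alpha> Rs by (simp add: exp_of_nat2_mult del: of_nat_Suc)
  define T where "T = (\<Sum>n. ennreal (real (Suc n) * d (Suc n) * ?R ^ Suc n))"
  have \<beta>: "lf_beta H g m = ennreal m * T"
    using ge by (simp only: lf_beta_def if_True pow d_seq_eq T_def)
  then have "T \<noteq> top" using fin m by (auto simp: ennreal_mult_top)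
  then show sm: "summable (\<lambda>n. real (Suc n) * d (Suc n) * ?R ^ Suc n)"
    unfolding T_def by (intro summable_suminf_not_top) (use d_nonneg s Rs in auto)
  then have "T = ennreal (\<Sum>n. real (Suc n) * d (Suc n) * ?R ^ Suc n)"
    unfolding T_def by (intro suminf_ennreal2) (use d_nonneg s Rs in auto)
  moreover have "0 \<le> (\<Sum>n. real (Suc n) * d (Suc n) * ?R ^ Suc n)"
    using sm by (intro suminf_nonneg) (use d_nonneg s Rs in auto)
  ultimately show "enn2real (lf_beta H g m) = m * (\<Sum>n. real (Suc n) * d (Suc n) * ?R ^ Suc n)"
    unfolding \<beta> using m by (simp add: enn2real_mult)
qed

end

section \<open>Transfer to the process\<close>

lemma cond_prob_gen_law:
  assumes Z: "BGW_process off i P Z" and pos: "pmf (gen_law off i n) {#} < 1"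
  shows "\<P>(\<omega> in P. Z n \<omega> \<noteq> {#}) = 1 - pmf (gen_law off i n) {#}"
    and "\<P>(\<omega> in P. Z n \<omega> = k \<bar> Z n \<omega> \<noteq> {#}) = pmf (cond_pmf (gen_law off i n) (- {{#}})) k"
proof -
  let ?q = "gen_law off i n"
  have [measurable]: "Z n \<in> measurable P (count_space UNIV)" using Z by (simp add: BGW_process_def)
  have law: "\<P>(\<omega> in P. Z n \<omega> \<in> A) = measure (measure_pmf ?q) A" for A
    unfolding BGW_process_law[OF Z, symmetric] by (subst measure_distr) (auto intro!: arg_cong[where f = "measure P"])
  have compl: "measure (measure_pmf ?q) (- {{#}}) = 1 - pmf ?q {#}"
    using measure_pmf.prob_compl[of "{{#}}" ?q] by (simp add: measure_pmf_single Compl_eq_Diff_UNIV)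
  show surv: "\<P>(\<omega> in P. Z n \<omega> \<noteq> {#}) = 1 - pmf ?q {#}"
    using law[of "- {{#}}"] compl by simp
  have ne: "set_pmf ?q \<inter> - {{#}} \<noteq> {}"
    using pos compl by (metis diff_gt_0_iff_gt less_irrefl measure_pmf_zero_iff)
  have "\<P>(\<omega> in P. Z n \<omega> = k \<and> Z n \<omega> \<noteq> {#}) = (if k = {#} then 0 else pmf ?q k)"
    using law[of "{k}"] by (auto simp: measure_pmf_single cong: conj_cong)
  then show "\<P>(\<omega> in P. Z n \<omega> = k \<bar> Z n \<omega> \<noteq> {#}) = pmf (cond_pmf ?q (- {{#}})) k"
    by (simp add: cond_prob_def surv pmf_cond[OF ne] compl)
qed

text \<open>Asserting the existence of \<open>Y\<close> loses nothing: a law is determined by its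
  generating function on the unit cube, as \<open>pmf_tendsto_of_pgf\<close> shows for a constant
  sequence. The same \<open>Y\<close> serves all initial types.\<close>

theorem proposition9:
  fixes H :: "nat \<Rightarrow> nat \<Rightarrow> real" and g :: "nat \<Rightarrow> real" and m :: real
    and P :: "nat \<Rightarrow> 'w measure" and Z :: "nat \<Rightarrow> 'w \<Rightarrow> nat multiset"
  assumes "sub_stochastic H" and "prob_vec g" and "0 < m"
    and "LF_BGW H g m P Z"
    and "irreducible_mat (mean_matrix P Z)"
    and "aperiodic_mat (mean_matrix P Z)"
    and "lf_beta H g m < \<infinity>"
  shows "mean_matrix P Z = (\<lambda>i j. H i j + m * row_sums H i * g j) \<and>
    (lf_rho H g m < 1 \<longleftrightarrow> lf_mu H g m < 1) \<and>
    (lf_rho H g m < 1 \<longrightarrow>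
      (\<forall>i. (\<lambda>n. \<P>(\<omega> in P i. Z n \<omega> \<noteq> {#})) \<sim>[sequentially]
             (\<lambda>n. lf_rho H g m ^ n / (1 + m) * (1 - enn2real (lf_mu H g m)) * lf_u H g m i)) \<and>
      h_tilde H g m (mean_matrix P Z) sums 1 \<and>
      (\<exists>Y. LF Y (h_tilde H g m (mean_matrix P Z)) (g_tilde H g m (mean_matrix P Z)) (m_tilde H g m) \<and>
         (\<forall>i k. (\<lambda>n. \<P>(\<omega> in P i. Z n \<omega> = k \<bar> Z n \<omega> \<noteq> {#})) \<longlonglongrightarrow> pmf Y k)))"
proof -
  interpret lf_params H g m by unfold_locales fact+
  obtain off where off: "\<And>i. LF (off i) (H i) g m" and Z: "\<And>i. BGW_process off i (P i) Z"
    using assms(4) unfolding LF_BGW_def by blast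
  have mean_M: "mean_matrix P Z = M"
  proof (intro ext)
    fix i j
    have [measurable]: "Z 1 \<in> measurable (P i) (count_space UNIV)" using Z[of i] by (simp add: BGW_process_def)
    have "mean_matrix P Z i j = (\<integral>x. real (count x j) \<partial>distr (P i) (count_space UNIV) (Z 1))"
      unfolding mean_matrix_def by (rule integral_distr[symmetric]) measurable
    also have "\<dots> = M i j"
      unfolding BGW_process_law[OF Z] by (rule expectation_count_offspring[OF off])
    finally show "mean_matrix P Z i j = M i j" .
  qed
  let ?R = "lf_R H g m"
  note Rfacts = R_of_beta_finite[OF assms(7)]
  interpret lf_recurrent H g m ?R
  proof
    show "irreducible_mat M" "aperiodic_mat M" using assms(5,6) by (simp_all add: mean_M)
    show "(\<lambda>n. d (Suc n) * ?R ^ Suc n) sums (1 / m)"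
      using Rfacts m by (intro sums_of_f_gen) auto
  qed (fact Rfacts)+
  have f1: "f_gen H g 1 = (\<Sum>n. ennreal (d (Suc n)))" using f_gen_eq[of 1] by simp
  have sub: "lf_subcritical H g m ?R" if "1 < ?R"
    by unfold_locales fact
  have \<mu>_eq: "f_gen H g 1 = ennreal (\<Sum>n. d (Suc n))" "lf_mu H g m = ennreal (m * (\<Sum>n. d (Suc n)))"
    "0 \<le> (\<Sum>n. d (Suc n))" if "1 < ?R"
  proof -
    interpret lf_subcritical H g m ?R by (rule sub[OF that])
    have s: "summable (\<lambda>n. d (Suc n))" using summable_d by (simp add: summable_Suc_iff)
    then show f: "f_gen H g 1 = ennreal (\<Sum>n. d (Suc n))" unfolding f1 by (intro suminf_ennreal2 d_nonneg)
    show "0 \<le> (\<Sum>n. d (Suc n))" using s by (intro suminf_nonneg d_nonneg)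
    show "lf_mu H g m = ennreal (m * (\<Sum>n. d (Suc n)))" unfolding lf_mu_def f using m by (simp add: ennreal_mult')
  qed
  have rho_R: "lf_rho H g m < 1 \<longleftrightarrow> 1 < ?R" using Rfacts(1) unfolding Rfacts(2) by simp
  have rho_mu: "lf_rho H g m < 1 \<longleftrightarrow> lf_mu H g m < 1"
  proof (cases "1 < ?R")
    case True
    interpret lf_subcritical H g m ?R by (rule sub[OF True])
    have "lf_mu H g m < 1" unfolding \<mu>_eq(2)[OF True] using \<mu>_less_1 by (simp add: \<mu>_def ennreal_less_one_iff)
    then show ?thesis using True rho_R by simp
  next
    \<comment> \<open>For R \<le> 1 monotonicity gives m f(1) \<ge> m f(R) = 1; this covers f(1) =
      \<infinity> as well.\<close>
    case False
    then have "ennreal (1 / m) \<le> f_gen H g 1"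
      using f_gen_mono[of "ennreal ?R" 1] Rfacts(3) by (simp add: ennreal_le_1)
    then have "ennreal m * ennreal (1 / m) \<le> lf_mu H g m" unfolding lf_mu_def by (intro mult_left_mono) auto
    moreover have "ennreal m * ennreal (1 / m) = 1" using m by (simp flip: ennreal_mult')
    ultimately show ?thesis using False rho_R by (simp add: not_less[symmetric])
  qed
  have main: "(\<forall>i. (\<lambda>n. \<P>(\<omega> in P i. Z n \<omega> \<noteq> {#})) \<sim>[sequentially]
             (\<lambda>n. lf_rho H g m ^ n / (1 + m) * (1 - enn2real (lf_mu H g m)) * lf_u H g m i)) \<and>
      h_tilde H g m M sums 1 \<and>
      (\<exists>Y. LF Y (h_tilde H g m M) (g_tilde H g m M) (m_tilde H g m) \<and>
         (\<forall>i k. (\<lambda>n. \<P>(\<omega> in P i. Z n \<omega> = k \<bar> Z n \<omega> \<noteq> {#})) \<longlonglongrightarrow> pmf Y k))"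
    if R1: "1 < ?R"
  proof -
    interpret lf_subcritical H g m ?R by (rule sub[OF R1])
    have mu: "enn2real (lf_mu H g m) = \<mu>" using \<mu>_eq[OF R1] m by (simp add: \<mu>_def)
    have lam: "enn2real (lf_lambda H g) = \<Lambda>"
      using \<mu>_eq(3)[OF R1] unfolding lf_lambda_def \<mu>_eq(1)[OF R1] \<Lambda>_def
      by (simp flip: ennreal_1 ennreal_plus)
    have h: "h_tilde H g m M = limit_h" unfolding h_tilde_def limit_h_def lf_v_def mu ..
    have g: "g_tilde H g m M = limit_g" unfolding g_tilde_def limit_g_def mu lam ..
    have mt: "m_tilde H g m = m * \<Lambda> / (1 - \<mu>)" unfolding m_tilde_def mu lam ..
    have u: "lf_u H g m i = (1 + m) / \<beta> * S i" for i
      unfolding lf_u_def S_def row_sums_mat_power[OF bH] Rfacts(5) \<beta>_def ..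
    have "0 < m * \<Lambda> / (1 - \<mu>)" using m \<Lambda>_pos \<mu>_less_1 by simp
    from LF_exists[OF prob_vec_limit_h prob_vec_limit_g this]
    obtain Y where Y: "LF Y limit_h limit_g (m * \<Lambda> / (1 - \<mu>))" by blast
    let ?\<sigma> = "\<lambda>n i. app_power M n ones i / denom n ones"
    have \<sigma>: "0 < ?\<sigma> n i" for n i using app_power_M_ones_pos denom_pos[OF bvec_ones] by simp
    have ext: "pmf (gen_law off i n) {#} < 1" for i n using \<sigma>[of n i] by (simp add: extinction[OF off])
    note Z_law = cond_prob_gen_law[OF Z ext]
    have "(\<lambda>n. \<P>(\<omega> in P i. Z n \<omega> \<noteq> {#})) \<sim>[sequentially]
             (\<lambda>n. lf_rho H g m ^ n / (1 + m) * (1 - \<mu>) * lf_u H g m i)" for i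
    proof (rule asymp_equivI')
      let ?c = "(1 - \<mu>) * S i / \<beta>"
      have c: "?c \<noteq> 0" using \<mu>_less_1 S_pos[of i] \<beta>_pos by simp
      have lim: "(\<lambda>n. ?R ^ n * ?\<sigma> n i / ?c) \<longlonglongrightarrow> 1"
        using tendsto_divide[OF survival_limit[of i] tendsto_const c] unfolding divide_self[OF c] .
      have ratio: "?R ^ n * ?\<sigma> n i / ?c =
          \<P>(\<omega> in P i. Z n \<omega> \<noteq> {#}) / (lf_rho H g m ^ n / (1 + m) * (1 - \<mu>) * lf_u H g m i)" for n
      proof -
        have "lf_rho H g m ^ n / (1 + m) * (1 - \<mu>) * lf_u H g m i = ?c / ?R ^ n"
          unfolding Rfacts(2) u using m by (simp add: power_one_over)
        then show ?thesis by (simp add: Z_law extinction[OF off])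
      qed
      show "(\<lambda>n. \<P>(\<omega> in P i. Z n \<omega> \<noteq> {#}) / (lf_rho H g m ^ n / (1 + m) * (1 - \<mu>) * lf_u H g m i)) \<longlonglongrightarrow> 1"
        using lim unfolding ratio .
    qed
    moreover have "limit_h sums 1" using prob_vec_limit_h by (simp add: prob_vec_def)
    moreover have "(\<lambda>n. \<P>(\<omega> in P i. Z n \<omega> = k \<bar> Z n \<omega> \<noteq> {#})) \<longlonglongrightarrow> pmf Y k" for i k
      unfolding Z_law by (rule conditional_limit[OF off Y])
    ultimately show ?thesis unfolding h g mt mu using Y by blast
  qed
  show ?thesis unfolding mean_M using rho_mu main rho_R M_def by simp
qed

end
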